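(* Let $f:\mathbb{R}^d\to\mathbb{R}$ be continuous with a unique $x^*\in\mathbb{R}^d$ such that $f(x^* )=\min f=:\underline f$; assume there is $L_f>0$ with $|f(x)-f(y)|\le L_f(1+|x|+|y|)|x-y|$ for all $x,y\in\mathbb{R}^d$, and there are $c_\ell,c_u,M>0$ with $f(x)-\underline f\le c_u(|x|^2+1)$ for all $x\in\mathbb{R}^d$ and $c_\ell|x|^2\le f(x)-\underline f$ for $|x|\ge M$. Let $\lambda,\delta>0$, and let $\rho_0\in\mathcal P_4(\mathbb{R}^d)$ and $\alpha>0$ be given. For each $\Delta t>0$, let $\varrho_t^{\alpha,1,\Delta t}$ be the solution (law) of the Consensus Freezing scheme with step size $\Delta t$, speed $s=1$, initial data $\rho_0$ and the given parameter $\alpha$; let $\rho_t^\alpha$ be the solution (law) of the $\delta$-CBO scheme with the same initial data $\rho_0$ (not necessarily Gaussian). Then, for every $T>0$, $$W_2(\varrho_t^{\alpha,1,\Delta t},\rho_t^\alpha)\to0\quad\text{as }\Delta t\to0,\ \text{uniformly for }t\in[0,T].$$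
   Context: For a probability measure $\rho$ on $\mathbb{R}^d$ and $\alpha>0$, the consensus point is $X^\alpha(\rho)=\frac{\int x e^{-\alpha f(x)}d\rho(x)}{\int e^{-\alpha f(x)}d\rho(x)}$. $W_2$ is the 2-Wasserstein distance; $\mathcal P_4(\mathbb{R}^d)$ is the set of probability measures with finite fourth moment. $\delta$-CBO scheme: $dX_t=-\lambda(X_t-X^\alpha(\rho_t^\alpha))dt+\delta\,dB_t$, $\rho_t^\alpha=\mathrm{Law}(X_t)$. Consensus Freezing scheme with $s=1$: $dX_t=-\lambda\big(X_t-X^\alpha(\varrho^{\alpha,1,\Delta t}_{t_i})\big)dt+\delta\,dB_t$ for $t\in[t_i,t_{i+1})$, $t_i=i\Delta t$, $\varrho^{\alpha,1,\Delta t}_t=\mathrm{Law}(X_t)$. *)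

theory Defs
  imports "HOL-Probability.Probability"
begin

text \<open>The space $R^d$ is an arbitrary type of class \<^class>\<open>euclidean_space\<close>; time is real, and
  processes have the type \<open>real \<Rightarrow> 'w \<Rightarrow> 'a\<close>, only their values at times \<open>t \<ge> 0\<close> being relevant.\<close>

definition P4 :: "'a::euclidean_space measure set" where
  "P4 = {\<rho>. prob_space \<rho> \<and> sets \<rho> = sets borel \<and> integrable \<rho> (\<lambda>x. norm x ^ 4)}"

definition consensus_point :: "('a::euclidean_space \<Rightarrow> real) \<Rightarrow> real \<Rightarrow> 'a measure \<Rightarrow> 'a" where
  "consensus_point f \<alpha> \<rho> =
     (\<integral>x. exp (- \<alpha> * f x) *\<^sub>R x \<partial>\<rho>) /\<^sub>R (\<integral>x. exp (- \<alpha> * f x) \<partial>\<rho>)"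

definition couplings :: "'a measure \<Rightarrow> 'b measure \<Rightarrow> ('a \<times> 'b) measure set" where
  "couplings \<mu> \<nu> =
     {\<gamma>. sets \<gamma> = sets (\<mu> \<Otimes>\<^sub>M \<nu>) \<and> distr \<gamma> \<mu> fst = \<mu> \<and> distr \<gamma> \<nu> snd = \<nu>}"

definition ennreal_sqrt :: "ennreal \<Rightarrow> ennreal" where
  "ennreal_sqrt x = (if x = \<top> then \<top> else ennreal (sqrt (enn2real x)))"

text \<open>Extended-valued, so that an infinite transport cost is not collapsed to \<open>0\<close>.\<close>

definition W2 :: "'a::euclidean_space measure \<Rightarrow> 'a measure \<Rightarrow> ennreal" where
  "W2 \<mu> \<nu> =
     (INF \<gamma>\<in>couplings \<mu> \<nu>. ennreal_sqrt (\<integral>\<^sup>+ (x, y). ennreal ((norm (x - y))\<^sup>2) \<partial>\<gamma>))"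

text \<open>Standard Brownian motion started at \<open>0\<close>, relative to a filtration \<open>F\<close> (which need not satisfy
  the usual conditions). The library's filtrations are indexed by the whole type \<^typ>\<open>real\<close>; a
  filtration on \<open>[0,\<infinity>)\<close> is extended by \<open>F t = F 0\<close> for \<open>t < 0\<close>. The density in \<open>increment_normal\<close> is
  that of the normal law with mean \<open>0\<close> and covariance \<open>t - s\<close> times the identity. Independence from
  \<open>F 0\<close> makes \<open>B\<close> independent of any \<open>F 0\<close>-measurable initial value.\<close>

locale brownian_motion = prob_space M + filtration "space M" F
  for M :: "'w measure" and F :: "real \<Rightarrow> 'w measure" +
  fixes B :: "real \<Rightarrow> 'w \<Rightarrow> 'a::euclidean_space"
  assumes subalgebra_F: "\<And>t. subalgebra M (F t)"
    and adapted: "\<And>t. 0 \<le> t \<Longrightarrow> B t \<in> borel_measurable (F t)"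
    and start_0: "AE \<omega> in M. B 0 \<omega> = 0"
    and continuous_paths: "AE \<omega> in M. continuous_on {0..} (\<lambda>t. B t \<omega>)"
    and increment_indep: "\<And>s t. 0 \<le> s \<Longrightarrow> s < t \<Longrightarrow>
      indep_set (sets (F s)) (sets (vimage_algebra (space M) (\<lambda>\<omega>. B t \<omega> - B s \<omega>) borel))"
    and increment_normal: "\<And>s t. 0 \<le> s \<Longrightarrow> s < t \<Longrightarrow>
      distributed M lborel (\<lambda>\<omega>. B t \<omega> - B s \<omega>)
        (\<lambda>x. ennreal (\<Prod>b\<in>Basis. normal_density 0 (sqrt (t - s)) (x \<bullet> b)))"

text \<open>\<open>dX = b(t, X) dt + \<delta> dB\<close> on \<open>[0,\<infinity>)\<close>. Since the diffusion coefficient is a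
  constant, the stochastic integral is \<open>\<delta> B\<^sub>t\<close> (\<open>B\<close> starts at \<open>0\<close>) and the equation can be read
  pathwise.\<close>

definition additive_sde_solution ::
  "(real \<Rightarrow> 'a::euclidean_space \<Rightarrow> 'a) \<Rightarrow> real \<Rightarrow>
   'w measure \<Rightarrow> (real \<Rightarrow> 'w measure) \<Rightarrow> (real \<Rightarrow> 'w \<Rightarrow> 'a) \<Rightarrow> (real \<Rightarrow> 'w \<Rightarrow> 'a) \<Rightarrow> bool" where
  "additive_sde_solution b \<delta> M F B X \<longleftrightarrow>
     brownian_motion M F B \<and>
     (\<forall>t\<ge>0. X t \<in> borel_measurable (F t)) \<and>
     (AE \<omega> in M. continuous_on {0..} (\<lambda>t. X t \<omega>)) \<and>
     (AE \<omega> in M. \<forall>t\<ge>0.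
        set_integrable lborel {0..t} (\<lambda>s. b s (X s \<omega>)) \<and>
        X t \<omega> = X 0 \<omega> + (LINT s:{0..t}|lborel. b s (X s \<omega>)) + \<delta> *\<^sub>R B t \<omega>)"

definition law :: "'w measure \<Rightarrow> (real \<Rightarrow> 'w \<Rightarrow> 'a::euclidean_space) \<Rightarrow> real \<Rightarrow> 'a measure" where
  "law M X t = distr M borel (X t)"

definition delta_cbo_solution ::
  "('a::euclidean_space \<Rightarrow> real) \<Rightarrow> real \<Rightarrow> real \<Rightarrow> real \<Rightarrow> 'a measure \<Rightarrow>
   'w measure \<Rightarrow> (real \<Rightarrow> 'w measure) \<Rightarrow> (real \<Rightarrow> 'w \<Rightarrow> 'a) \<Rightarrow> (real \<Rightarrow> 'w \<Rightarrow> 'a) \<Rightarrow> bool" where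
  "delta_cbo_solution f lam \<delta> \<alpha> \<rho>0 M F B X \<longleftrightarrow>
     additive_sde_solution
       (\<lambda>t x. - lam *\<^sub>R (x - consensus_point f \<alpha> (law M X t))) \<delta> M F B X \<and>
     law M X 0 = \<rho>0"

definition grid_time :: "real \<Rightarrow> real \<Rightarrow> real" where
  "grid_time h t = of_int \<lfloor>t / h\<rfloor> * h"

lemma grid_time_eq:
  fixes i :: nat
  assumes "h > 0" "real i * h \<le> t" "t < real (Suc i) * h"
  shows "grid_time h t = real i * h"
proof -
  have "\<lfloor>t / h\<rfloor> = int i"
    using assms by (intro floor_unique) (simp_all add: field_simps)
  then show ?thesis by (simp add: grid_time_def)
qed

text \<open>Consensus freezing with speed \<open>1\<close> and step \<open>h\<close>.\<close>

definition consensus_freezing_solution ::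
  "('a::euclidean_space \<Rightarrow> real) \<Rightarrow> real \<Rightarrow> real \<Rightarrow> real \<Rightarrow> real \<Rightarrow> 'a measure \<Rightarrow>
   'w measure \<Rightarrow> (real \<Rightarrow> 'w measure) \<Rightarrow> (real \<Rightarrow> 'w \<Rightarrow> 'a) \<Rightarrow> (real \<Rightarrow> 'w \<Rightarrow> 'a) \<Rightarrow> bool" where
  "consensus_freezing_solution f lam \<delta> \<alpha> h \<rho>0 M F B X \<longleftrightarrow>
     additive_sde_solution
       (\<lambda>t x. - lam *\<^sub>R (x - consensus_point f \<alpha> (law M X (grid_time h t)))) \<delta> M F B X \<and>
     law M X 0 = \<rho>0"

end

theory Submission
  imports Defs
begin

text \<open>The drift is linear and the consensus points enter both equations only as deterministic forcings
  \<open>m\<close>. Hence each solution is a deterministic path plus an Ornstein--Uhlenbeck process whose law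
  depends on \<open>\<rho>0\<close>, \<open>lam\<close> and \<open>\<delta>\<close> alone; the latter holds because the Ornstein--Uhlenbeck process is a
  pathwise limit of Riemann sums of \<open>X 0 + \<delta> B\<close>. So the frozen law at time \<open>t\<close> is the CBO law
  translated by a vector \<open>r t\<close>, and \<open>W2\<close> is at most \<open>norm (r t)\<close>. The offset \<open>r\<close> solves a linear
  ordinary differential equation driven by the difference of the consensus points. By the quadratic
  lower growth bound the weight \<open>exp (- \<alpha> f x)\<close> and its product with \<open>x\<close> are bounded and Lipschitz, so the
  consensus point is Lipschitz under small translations and continuous in time along the CBO law;
  a Gronwall argument shows that \<open>r\<close> tends to \<open>0\<close> uniformly.\<close>

section \<open>The Gibbs weight\<close>

text \<open>By convexity the slope of a chord of the exponential is at most the derivative at its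
  larger endpoint; the inequality \<open>1 + u \<le> exp u\<close> is all this takes.\<close>

lemma abs_exp_diff_le:
  fixes a b :: real
  shows "\<bar>exp a - exp b\<bar> \<le> \<bar>a - b\<bar> * max (exp a) (exp b)"
proof -
  have *: "exp v - exp u \<le> (v - u) * exp v" for u v :: real
  proof -
    have "exp v * (1 + (u - v)) \<le> exp v * exp (u - v)"
      by (intro mult_left_mono exp_ge_add_one_self) simp
    also have "\<dots> = exp u" by (simp flip: exp_add)
    finally show ?thesis by (simp add: algebra_simps)
  qed
  show ?thesis
  proof (cases "a \<le> b")
    case True
    then show ?thesis using *[of b a] by (simp add: max_def)
  next
    case False
    then show ?thesis using *[of a b] by (simp add: max_def)
  qed
qed

text \<open>Outside a ball the weight is dominated by a Gaussian, which beats every power. The cube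
  dominates each factor met later: 1, \<open>norm x\<close> and the square of
  \<open>1 + norm x\<close>.\<close>

lemma gibbs_weight_decay:
  fixes f :: "'a::real_normed_vector \<Rightarrow> real"
  assumes f_min: "\<And>x. m \<le> f x"
    and cl: "cl > 0" and f_lower: "\<And>x. norm x \<ge> K \<Longrightarrow> cl * (norm x)\<^sup>2 \<le> f x - m"
    and \<alpha>: "\<alpha> > 0"
  obtains C where "\<And>x. (1 + norm x) ^ 3 * exp (- \<alpha> * f x) \<le> C"
proof -
  \<comment> \<open>Beyond \<open>R\<close> both the quadratic growth bound and
    \<open>1 + n \<le> 2 * n\<close> are available.\<close>
  define R where "R = max 1 K"
  define C where "C = max ((1 + R) ^ 3 * exp (- \<alpha> * m)) (16 * exp (- \<alpha> * m) / (\<alpha> * cl)\<^sup>2)"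
  have "(1 + norm x) ^ 3 * exp (- \<alpha> * f x) \<le> C" for x
  proof (cases "norm x \<le> R")
    case True
    have "(1 + norm x) ^ 3 * exp (- \<alpha> * f x) \<le> (1 + R) ^ 3 * exp (- \<alpha> * m)"
      using True f_min \<alpha> by (intro mult_mono power_mono) (auto simp: R_def)
    then show ?thesis by (simp add: C_def)
  next
    case False
    define n where "n = norm x"
    define a where "a = \<alpha> * cl"
    have n: "n > 1" "n \<ge> K" using False by (auto simp: R_def n_def)
    have a: "a > 0" using \<alpha> cl by (simp add: a_def)
    have "f x \<ge> m + cl * n\<^sup>2" using f_lower[of x] n by (simp add: n_def)
    then have "\<alpha> * (m + cl * n\<^sup>2) \<le> \<alpha> * f x" using \<alpha> by (intro mult_left_mono) auto
    then have 1: "exp (- \<alpha> * f x) \<le> exp (- \<alpha> * m) * exp (- (a * n\<^sup>2))"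
      by (simp add: a_def algebra_simps flip: exp_add)
    \<comment> \<open>The quadratic Taylor term of the exponential yields decay of order four in
      \<open>n\<close>; its factor 2 and the 8 from the cube of \<open>2 * n\<close> make the 16 in
      \<open>C\<close>.\<close>
    have "(a * n\<^sup>2)\<^sup>2 / 2 \<le> exp (a * n\<^sup>2)"
      using exp_lower_Taylor_quadratic[of "a * n\<^sup>2"] a by (smt (verit) mult_nonneg_nonneg zero_le_power2)
    then have "a\<^sup>2 * n ^ 4 / 2 \<le> exp (a * n\<^sup>2)"
      by (simp add: power_mult_distrib flip: power_mult)
    then have 2: "exp (- (a * n\<^sup>2)) \<le> 2 / (a\<^sup>2 * n ^ 4)"
      using a n by (simp add: exp_minus field_simps)
    have "(1 + n) ^ 3 \<le> (2 * n) ^ 3" using n by (intro power_mono) auto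
    also have "\<dots> = 8 * n ^ 3" by (simp add: power_mult_distrib)
    also have "\<dots> \<le> 8 * n ^ 4" using n by (auto intro!: power_increasing)
    finally have 3: "(1 + n) ^ 3 \<le> 8 * n ^ 4" .
    have "(1 + n) ^ 3 * exp (- \<alpha> * f x) \<le> (8 * n ^ 4) * (exp (- \<alpha> * m) * (2 / (a\<^sup>2 * n ^ 4)))"
      using n by (intro mult_mono 3 order_trans[OF 1] mult_left_mono 2) auto
    also have "\<dots> = 16 * exp (- \<alpha> * m) / a\<^sup>2" using n by simp
    finally show ?thesis by (simp add: C_def n_def a_def)
  qed
  then show ?thesis using that by blast
qed

text \<open>The local Lipschitz constant of \<open>f\<close> grows linearly, but the decay of the
  weight absorbs it, and at distance at most 1 the two points have comparable size. At larger
  distance boundedness alone suffices.\<close>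

lemma gibbs_weight_lipschitz:
  fixes f :: "'a::real_normed_vector \<Rightarrow> real"
  assumes C: "\<And>x. (1 + norm x) ^ 3 * exp (- \<alpha> * f x) \<le> C"
    and Lf: "Lf > 0" and \<alpha>: "\<alpha> > 0"
    and f_lipschitz: "\<And>x y. \<bar>f x - f y\<bar> \<le> Lf * (1 + norm x + norm y) * norm (x - y)"
  obtains L where "L > 0"
    and "\<And>x y. \<bar>exp (- \<alpha> * f x) - exp (- \<alpha> * f y)\<bar> \<le> L * norm (x - y)"
    and "\<And>x y. norm (exp (- \<alpha> * f x) *\<^sub>R x - exp (- \<alpha> * f y) *\<^sub>R y) \<le> L * norm (x - y)"
proof -
  define w where "w = (\<lambda>x. exp (- \<alpha> * f x))"
  define p where "p = (\<lambda>x::'a. 1 + norm x)"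
  have w_pos: "w x > 0" for x by (simp add: w_def)
  have p1: "p x \<ge> 1" for x by (simp add: p_def)
  have C: "p x ^ 3 * w x \<le> C" for x using C by (simp add: w_def p_def)
  have C_pos: "C > 0"
    by (rule less_le_trans[OF _ C[of 0]]) (simp add: w_pos p_def)
  have w_le: "w x \<le> C" for x
    using C[of x] w_pos[of x] one_le_power[OF p1[of x], of 3]
    by (smt (verit) mult_le_cancel_right1)
  have xw_le: "norm x * w x \<le> C" for x
  proof -
    have "norm x * w x \<le> p x ^ 3 * w x"
      using w_pos[of x] p1[of x] power_increasing[of 1 3 "p x"]
      by (intro mult_right_mono) (auto simp: p_def)
    then show ?thesis using C[of x] by simp
  qed
  \<comment> \<open>The 8 is the product of the constants in \<open>p y \<le> 2 * p z\<close> and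
    \<open>1 + norm x + norm y \<le> 4 * p z\<close>, valid at distance at most 1.\<close>
  define D where "D = 8 * \<alpha> * Lf * C"
  have D: "D > 0" using \<alpha> Lf C_pos by (simp add: D_def)
  \<comment> \<open>The factor \<open>p y\<close> is carried along so that the same estimate
    controls the term \<open>(w x - w y) *\<^sub>R y\<close> of the vector case.\<close>
  have near: "p y * \<bar>w x - w y\<bar> \<le> D * norm (x - y)" if xy: "norm (x - y) \<le> 1" for x y
  proof -
    have pp: "p x \<le> 2 * p y" "p y \<le> 2 * p x"
      using norm_triangle_sub[of x y] norm_triangle_sub[of y x] xy norm_ge_zero[of x] norm_ge_zero[of y]
      unfolding p_def norm_minus_commute[of y x] by argo+
    have bd: "p y * ((1 + norm x + norm y) * w z) \<le> 8 * C" if "z = x \<or> z = y" for z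
    proof -
      have "p y \<le> 2 * p z" "1 + norm x + norm y \<le> 4 * p z"
        using that pp xy norm_ge_zero[of x] norm_ge_zero[of y] unfolding p_def by (auto simp: p_def)
      then have "p y * (1 + norm x + norm y) \<le> (2 * p z) * (4 * p z)"
        using p1[of y] p1[of z] by (intro mult_mono) auto
      also have "\<dots> = 8 * p z ^ 2" by (simp add: power2_eq_square)
      also have "\<dots> \<le> 8 * p z ^ 3" using p1[of z] by (auto intro!: power_increasing)
      finally have "p y * (1 + norm x + norm y) * w z \<le> 8 * p z ^ 3 * w z"
        using w_pos[of z] by (intro mult_right_mono) auto
      then show ?thesis using C[of z] by (simp add: mult.assoc)
    qed
    have "\<bar>w x - w y\<bar> \<le> \<bar>- \<alpha> * f x - - \<alpha> * f y\<bar> * max (w x) (w y)"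
      unfolding w_def by (rule abs_exp_diff_le)
    also have "\<bar>- \<alpha> * f x - - \<alpha> * f y\<bar> = \<alpha> * \<bar>f x - f y\<bar>"
      using \<alpha> by (simp add: abs_mult abs_minus_commute flip: right_diff_distrib')
    also have "\<alpha> * \<bar>f x - f y\<bar> * max (w x) (w y) \<le>
        \<alpha> * (Lf * (1 + norm x + norm y) * norm (x - y)) * max (w x) (w y)"
      using \<alpha> f_lipschitz w_pos[of x] by (intro mult_right_mono mult_left_mono) (auto simp: max_def less_imp_le)
    finally have "p y * \<bar>w x - w y\<bar> \<le>
        p y * (\<alpha> * (Lf * (1 + norm x + norm y) * norm (x - y)) * max (w x) (w y))"
      using p1[of y] by (intro mult_left_mono) auto
    also have "\<dots> = \<alpha> * Lf * norm (x - y) * (p y * ((1 + norm x + norm y) * max (w x) (w y)))"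
      by (simp add: ac_simps)
    also have "\<dots> \<le> \<alpha> * Lf * norm (x - y) * (8 * C)"
      using bd[of x] bd[of y] \<alpha> Lf by (intro mult_left_mono) (auto simp: max_def)
    finally show ?thesis by (simp add: D_def ac_simps)
  qed
  \<comment> \<open>\<open>2 * C\<close> serves points at distance above 1; \<open>D\<close> and, in
    the vector case, \<open>C + D\<close> serve nearby points.\<close>
  define L where "L = 2 * C + D"
  have "\<bar>w x - w y\<bar> \<le> L * norm (x - y)" for x y
  proof (cases "norm (x - y) \<le> 1")
    case True
    have "\<bar>w x - w y\<bar> \<le> p y * \<bar>w x - w y\<bar>"
      using mult_right_mono[OF p1[of y], of "\<bar>w x - w y\<bar>"] by simp
    also have "\<dots> \<le> D * norm (x - y)" using near True .
    also have "\<dots> \<le> L * norm (x - y)" using C_pos by (intro mult_right_mono) (auto simp: L_def)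
    finally show ?thesis .
  next
    case False
    have "\<bar>w x - w y\<bar> \<le> 2 * C * 1" using w_le[of x] w_le[of y] w_pos[of x] w_pos[of y] by linarith
    also have "\<dots> \<le> L * norm (x - y)"
      using False C_pos D by (intro mult_mono) (auto simp: L_def)
    finally show ?thesis .
  qed
  moreover have "norm (w x *\<^sub>R x - w y *\<^sub>R y) \<le> L * norm (x - y)" for x y
  proof (cases "norm (x - y) \<le> 1")
    case True
    have "w x *\<^sub>R x - w y *\<^sub>R y = w x *\<^sub>R (x - y) + (w x - w y) *\<^sub>R y"
      by (simp add: algebra_simps)
    then have "norm (w x *\<^sub>R x - w y *\<^sub>R y) \<le> w x * norm (x - y) + \<bar>w x - w y\<bar> * norm y"
      by (metis norm_scaleR norm_triangle_ineq abs_of_pos w_pos)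
    also have "\<bar>w x - w y\<bar> * norm y \<le> p y * \<bar>w x - w y\<bar>"
      by (subst mult.commute, intro mult_right_mono) (auto simp: p_def)
    also have "\<dots> \<le> D * norm (x - y)" using near True .
    also have "w x * norm (x - y) \<le> C * norm (x - y)" using w_le by (intro mult_right_mono) auto
    finally have "norm (w x *\<^sub>R x - w y *\<^sub>R y) \<le> (C + D) * norm (x - y)" by (simp add: algebra_simps)
    also have "\<dots> \<le> L * norm (x - y)" using C_pos by (intro mult_right_mono) (auto simp: L_def)
    finally show ?thesis .
  next
    case False
    have "norm (w x *\<^sub>R x - w y *\<^sub>R y) \<le> norm x * w x + norm y * w y"
      using norm_triangle_ineq4[of "w x *\<^sub>R x" "w y *\<^sub>R y"] w_pos[of x] w_pos[of y] by (simp add: mult.commute)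
    also have "\<dots> \<le> 2 * C * 1" using xw_le[of x] xw_le[of y] by linarith
    also have "\<dots> \<le> L * norm (x - y)"
      using False C_pos D by (intro mult_mono) (auto simp: L_def)
    finally show ?thesis .
  qed
  moreover have "L > 0" using C_pos D by (simp add: L_def)
  ultimately show ?thesis using that[of L] by (simp add: w_def)
qed

section \<open>Linear Volterra equations and Riemann sums\<close>

lemma continuous_on_atLeastI:
  fixes g :: "real \<Rightarrow> 'a::topological_space"
  assumes "\<And>t. a \<le> t \<Longrightarrow> continuous_on {a..t} g"
  shows "continuous_on {a..} g"
  unfolding continuous_on_eq_continuous_within
proof
  fix t :: real assume t: "t \<in> {a..}"
  have "at t within {a..} = at t within {a..t + 1}"
    by (rule at_within_nhd[of _ "{..<t + 1}"]) auto
  moreover have "continuous (at t within {a..t + 1}) g"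
    using assms[of "t + 1"] t by (auto simp: continuous_on_eq_continuous_within)
  ultimately show "continuous (at t within {a..}) g" by simp
qed

text \<open>Variation of constants: the integral of \<open>x\<close> up to \<open>s\<close>,
  multiplied by \<open>exp (- c * (t - s))\<close>, is an antiderivative of the weighted input. No
  derivative of \<open>u\<close> occurs, so a Brownian path is an admissible input.\<close>

lemma volterra_solution:
  fixes x u :: "real \<Rightarrow> 'a::banach"
  assumes x: "continuous_on {0..} x" and t: "t \<ge> 0"
    and u: "\<And>s. s \<ge> 0 \<Longrightarrow> u s = x s + c *\<^sub>R integral {0..s} x"
  shows "x t = u t - c *\<^sub>R integral {0..t} (\<lambda>s. exp (- c * (t - s)) *\<^sub>R u s)"
proof -
  let ?I = "\<lambda>s. integral {0..s} x"
  have x': "continuous_on {0..t} x" by (rule continuous_on_subset[OF x]) auto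
  have "((\<lambda>s. exp (- c * (t - s)) *\<^sub>R u s) has_integral
      exp (- c * (t - t)) *\<^sub>R ?I t - exp (- c * (t - 0)) *\<^sub>R ?I 0) {0..t}"
  proof (rule fundamental_theorem_of_calculus[OF t])
    fix s assume s: "s \<in> {0..t}"
    have "((\<lambda>s. exp (- c * (t - s)) *\<^sub>R ?I s) has_vector_derivative
        exp (- c * (t - s)) *\<^sub>R x s + (c * exp (- c * (t - s))) *\<^sub>R ?I s) (at s within {0..t})"
      by (rule has_vector_derivative_scaleR[OF _ integral_has_vector_derivative[OF x' s]])
        (auto intro!: derivative_eq_intros)
    then show "((\<lambda>s. exp (- c * (t - s)) *\<^sub>R ?I s) has_vector_derivative
        exp (- c * (t - s)) *\<^sub>R u s) (at s within {0..t})"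
      using s by (simp add: u algebra_simps)
  qed
  then have "integral {0..t} (\<lambda>s. exp (- c * (t - s)) *\<^sub>R u s) = ?I t"
    by (simp add: integral_unique)
  then show ?thesis using u[OF t] by simp
qed

text \<open>The variation-of-constants formula, written with the integrating factor
  \<open>exp (c * s)\<close>, does solve the equation. It later produces the deterministic part of a
  solution.\<close>

lemma volterra_exists:
  fixes u :: "real \<Rightarrow> 'a::banach"
  assumes u: "continuous_on {0..} u"
  obtains x where "continuous_on {0..} x"
    and "\<And>t. t \<ge> 0 \<Longrightarrow> u t = x t + c *\<^sub>R integral {0..t} x"
proof -
  define K where "K = (\<lambda>t. integral {0..t} (\<lambda>s. exp (c * s) *\<^sub>R u s))"
  define x where "x = (\<lambda>t. u t - c *\<^sub>R (exp (- c * t) *\<^sub>R K t))"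
  have cont: "continuous_on {0..t} (\<lambda>s. exp (c * s) *\<^sub>R u s)" for t
    by (intro continuous_intros continuous_on_subset[OF u]) auto
  have K_cont: "continuous_on {0..t} K" for t
    unfolding K_def by (intro indefinite_integral_continuous_1 integrable_continuous_real cont)
  have "continuous_on {0..} x" unfolding x_def
    by (intro continuous_intros u continuous_on_atLeastI K_cont)
  moreover have "u t = x t + c *\<^sub>R integral {0..t} x" if t: "t \<ge> 0" for t
  proof -
    have "(x has_integral exp (- c * t) *\<^sub>R K t - exp (- c * 0) *\<^sub>R K 0) {0..t}"
    proof (rule fundamental_theorem_of_calculus[OF t])
      fix s assume s: "s \<in> {0..t}"
      have "((\<lambda>s. exp (- c * s) *\<^sub>R K s) has_vector_derivative
          exp (- c * s) *\<^sub>R (exp (c * s) *\<^sub>R u s) + (- c * exp (- c * s)) *\<^sub>R K s) (at s within {0..t})"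
        unfolding K_def
        by (rule has_vector_derivative_scaleR[OF _ integral_has_vector_derivative[OF cont s]])
          (auto intro!: derivative_eq_intros)
      then show "((\<lambda>s. exp (- c * s) *\<^sub>R K s) has_vector_derivative x s) (at s within {0..t})"
        by (simp add: x_def flip: exp_add)
    qed
    then have "integral {0..t} x = exp (- c * t) *\<^sub>R K t"
      by (simp add: integral_unique K_def)
    then show ?thesis by (simp add: x_def)
  qed
  ultimately show ?thesis using that by blast
qed

section \<open>Left-endpoint Riemann sums\<close>

lemma riemann_sum_error:
  fixes \<psi> :: "real \<Rightarrow> 'a::banach"
  assumes cont: "continuous_on {0..real n * h} \<psi>" and h: "h \<ge> 0"
    and osc: "\<And>r s. r \<in> {0..real n * h} \<Longrightarrow> s \<in> {0..real n * h} \<Longrightarrow> \<bar>r - s\<bar> \<le> h \<Longrightarrow> norm (\<psi> r - \<psi> s) \<le> e"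
  shows "norm (integral {0..real n * h} \<psi> - (\<Sum>k<n. h *\<^sub>R \<psi> (real k * h))) \<le> real n * h * e"
  using cont osc
proof (induction n)
  case (Suc n)
  let ?a = "real n * h" and ?b = "real (Suc n) * h"
  have ab: "0 \<le> ?a" "?a \<le> ?b" using h by (auto intro: mult_right_mono)
  have int: "\<psi> integrable_on {0..?b}" by (rule integrable_continuous_real[OF Suc.prems(1)])
  have int': "\<psi> integrable_on {?a..?b}"
    by (rule integrable_subinterval_real[OF int]) (use ab in auto)
  have IH: "norm (integral {0..?a} \<psi> - (\<Sum>k<n. h *\<^sub>R \<psi> (real k * h))) \<le> ?a * e"
  proof (rule Suc.IH)
    show "continuous_on {0..?a} \<psi>" by (rule continuous_on_subset[OF Suc.prems(1)]) (use ab in auto)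
  qed (use ab Suc.prems(2) in auto)
  have eq: "integral {?a..?b} (\<lambda>s. \<psi> s - \<psi> ?a) = integral {?a..?b} \<psi> - h *\<^sub>R \<psi> ?a"
    using ab by (subst integral_diff[OF int' integrable_const_ivl]) (simp add: algebra_simps)
  have "norm (integral {?a..?b} (\<lambda>s. \<psi> s - \<psi> ?a)) \<le> e * (?b - ?a)"
  proof (rule integral_bound)
    show "continuous_on {?a..?b} (\<lambda>s. \<psi> s - \<psi> ?a)"
      by (intro continuous_intros continuous_on_subset[OF Suc.prems(1)]) (use ab in auto)
    show "norm (\<psi> s - \<psi> ?a) \<le> e" if "s \<in> {?a..?b}" for s
      using that ab order_trans[of 0 ?a s] by (intro Suc.prems(2)) (simp_all add: algebra_simps)
  qed (use ab in auto)
  then have step: "norm (integral {?a..?b} \<psi> - h *\<^sub>R \<psi> ?a) \<le> h * e"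
    unfolding eq by (simp add: algebra_simps)
  have "integral {0..?b} \<psi> - (\<Sum>k<Suc n. h *\<^sub>R \<psi> (real k * h)) =
      (integral {0..?a} \<psi> - (\<Sum>k<n. h *\<^sub>R \<psi> (real k * h))) + (integral {?a..?b} \<psi> - h *\<^sub>R \<psi> ?a)"
    by (subst Henstock_Kurzweil_Integration.integral_combine[OF ab int, symmetric]) (simp add: algebra_simps)
  also have "norm \<dots> \<le> ?a * e + h * e" by (rule norm_triangle_le[OF add_mono[OF IH step]])
  finally show ?case by (simp add: algebra_simps)
qed simp

text \<open>This turns a path integral into a limit of finite linear combinations of path values,
  whose laws can be compared. \<open>Suc n\<close> cells avoid a division by zero.\<close>

lemma riemann_sums_tendsto:
  fixes \<psi> :: "real \<Rightarrow> 'a::banach"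
  assumes cont: "continuous_on {0..t} \<psi>" and t: "t \<ge> 0"
  shows "(\<lambda>n. \<Sum>k<Suc n. (t / Suc n) *\<^sub>R \<psi> (real k * (t / Suc n))) \<longlonglongrightarrow> integral {0..t} \<psi>"
proof (rule metric_LIMSEQ_I)
  fix r :: real assume r: "r > 0"
  \<comment> \<open>The accumulated error is at most \<open>t * e\<close>; the \<open>+ 1\<close>
    makes this strictly less than \<open>r\<close> and covers \<open>t = 0\<close>.\<close>
  define e where "e = r / (t + 1)"
  have e: "e > 0" using r t by (simp add: e_def)
  obtain d where d: "d > 0" "\<And>x y. x \<in> {0..t} \<Longrightarrow> y \<in> {0..t} \<Longrightarrow> dist y x < d \<Longrightarrow> dist (\<psi> y) (\<psi> x) < e"
    using compact_uniformly_continuous[OF cont compact_Icc] e unfolding uniformly_continuous_on_def by metis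
  have "(\<lambda>n. t / Suc n) \<longlonglongrightarrow> 0" by real_asymp
  then have "\<forall>\<^sub>F n in sequentially. t / Suc n < d" using d(1) by (rule order_tendstoD)
  then obtain N where N: "\<And>n. n \<ge> N \<Longrightarrow> t / Suc n < d" by (auto simp: eventually_sequentially)
  have "dist (\<Sum>k<Suc n. (t / Suc n) *\<^sub>R \<psi> (real k * (t / Suc n))) (integral {0..t} \<psi>) < r" if n: "n \<ge> N" for n
  proof -
    define h where "h = t / Suc n"
    have h: "real (Suc n) * h = t" by (simp add: h_def)
    have "norm (integral {0..real (Suc n) * h} \<psi> - (\<Sum>k<Suc n. h *\<^sub>R \<psi> (real k * h))) \<le> real (Suc n) * h * e"
    proof (rule riemann_sum_error; (unfold h)?)
      show "norm (\<psi> a - \<psi> b) \<le> e" if "a \<in> {0..t}" "b \<in> {0..t}" "\<bar>a - b\<bar> \<le> h" for a b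
        using d(2)[of b a] that N[OF n] by (simp add: dist_norm h_def)
    qed (use t cont in \<open>auto simp: h_def\<close>)
    also have "real (Suc n) * h * e < r" unfolding h e_def using r t by (simp add: field_simps)
    finally show ?thesis unfolding h by (simp add: h_def dist_norm norm_minus_commute)
  qed
  then show "\<exists>no. \<forall>n\<ge>no. dist (\<Sum>k<Suc n. (t / Suc n) *\<^sub>R \<psi> (real k * (t / Suc n))) (integral {0..t} \<psi>) < r"
    by blast
qed

text \<open>The integral inequality is required only as long as the bound itself holds, which suffices since
  it fails at the first time of equality.\<close>

lemma gronwall_bootstrap:
  fixes e :: "real \<Rightarrow> real"
  assumes e: "continuous_on {0..T} e" and L: "L > 0" and \<eta>: "e 0 < \<eta>" "A < \<eta>"
    and step: "\<And>t. 0 < t \<Longrightarrow> t \<le> T \<Longrightarrow> (\<And>s. 0 \<le> s \<Longrightarrow> s < t \<Longrightarrow> e s < \<eta> * exp (L * s)) \<Longrightarrow>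
      e t \<le> A + L * integral {0..t} (\<lambda>s. \<eta> * exp (L * s))"
    and t: "t \<in> {0..T}"
  shows "e t < \<eta> * exp (L * t)"
proof (rule ccontr)
  assume not: "\<not> ?thesis"
  \<comment> \<open>The set of failure times is closed, so its infimum is a first failure, before
    which the bound holds and \<open>step\<close> applies.\<close>
  define S where "S = {s \<in> {0..T}. \<eta> * exp (L * s) \<le> e s}"
  have "closed S" unfolding S_def
    by (rule continuous_on_closed_Collect_le) (auto intro!: continuous_intros e)
  moreover have ne: "S \<noteq> {}" using not t by (auto simp: S_def)
  moreover have bdd: "bdd_below S" unfolding S_def by (rule bdd_belowI[of _ 0]) auto
  ultimately have "Inf S \<in> S" by (intro closed_contains_Inf)
  define m where "m = Inf S"
  have m: "0 \<le> m" "m \<le> T" "\<eta> * exp (L * m) \<le> e m"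
    using \<open>Inf S \<in> S\<close> by (auto simp: S_def m_def)
  have below: "e s < \<eta> * exp (L * s)" if "0 \<le> s" "s < m" for s
    using that cInf_lower[OF _ bdd, of s] m by (force simp: S_def m_def)
  have "m \<noteq> 0" using m \<eta> by auto
  then have "e m \<le> A + L * integral {0..m} (\<lambda>s. \<eta> * exp (L * s))"
    using step[OF _ _ below] m by simp
  also have "integral {0..m} (\<lambda>s. \<eta> * exp (L * s)) = \<eta> / L * exp (L * m) - \<eta> / L * exp (L * 0)"
    by (intro integral_unique fundamental_theorem_of_calculus)
      (use m L in \<open>auto intro!: derivative_eq_intros simp flip: has_real_derivative_iff_has_vector_derivative\<close>)
  \<comment> \<open>The right-hand side has become \<open>A - \<eta> + \<eta> * exp (L * m)\<close>,
    so \<open>A < \<eta>\<close> decides.\<close>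
  also have "A + L * \<dots> < \<eta> * exp (L * m)" using L \<eta> by (simp add: algebra_simps)
  finally show False using m by simp
qed

section \<open>Equality of laws and Brownian sums\<close>

text \<open>The indicator of an open set is a pointwise limit of truncated multiples of the distance
  to its complement, and the open sets are an intersection-stable generator.\<close>

lemma borel_prob_eqI_bounded_continuous:
  fixes \<mu> \<nu> :: "'a::metric_space measure"
  assumes "prob_space \<mu>" "prob_space \<nu>"
    and sets: "sets \<mu> = sets borel" "sets \<nu> = sets borel"
    and eq: "\<And>\<phi>::'a \<Rightarrow> real. continuous_on UNIV \<phi> \<Longrightarrow> (\<And>x. 0 \<le> \<phi> x) \<Longrightarrow> (\<And>x. \<phi> x \<le> 1) \<Longrightarrow>
      integral\<^sup>L \<mu> \<phi> = integral\<^sup>L \<nu> \<phi>"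
  shows "\<mu> = \<nu>"
proof -
  interpret \<mu>: prob_space \<mu> by fact
  interpret \<nu>: prob_space \<nu> by fact
  have open_eq: "emeasure \<mu> U = emeasure \<nu> U" if U: "open U" for U
  proof (cases "U = UNIV")
    case True
    then show ?thesis
      using \<mu>.emeasure_space_1 \<nu>.emeasure_space_1 sets[THEN sets_eq_imp_space_eq] by simp
  next
    case False
    \<comment> \<open>The case \<open>U = UNIV\<close> is separate because \<open>infdist\<close> to
      the empty set is 0 by convention, which would make these functions vanish.\<close>
    define \<phi> where "\<phi> = (\<lambda>n::nat. \<lambda>x. min 1 (real n * infdist x (- U)))"
    have cont: "continuous_on UNIV (\<phi> n)" for n
      unfolding \<phi>_def by (intro continuous_intros)
    have lim: "(\<lambda>n. \<phi> n x) \<longlonglongrightarrow> indicator U x" for x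
    proof (cases "x \<in> U")
      case True
      have "infdist x (- U) \<noteq> 0"
        using True False in_closed_iff_infdist_zero[of "- U" x] U by auto
      then have "infdist x (- U) > 0" using infdist_nonneg[of x "- U"] by linarith
      then have "filterlim (\<lambda>n. real n * infdist x (- U)) at_top sequentially"
        by (intro filterlim_at_top_mult_tendsto_pos[OF tendsto_const] filterlim_real_sequentially)
      then have "\<forall>\<^sub>F n in sequentially. 1 \<le> real n * infdist x (- U)"
        by (simp add: filterlim_at_top)
      then have "\<forall>\<^sub>F n in sequentially. \<phi> n x = indicator U x"
        by eventually_elim (use True in \<open>simp add: \<phi>_def\<close>)
      then show ?thesis by (rule tendsto_eventually)
    next
      case False
      then show ?thesis by (simp add: \<phi>_def)
    qed
    have "(\<lambda>n. integral\<^sup>L \<kappa> (\<phi> n)) \<longlonglongrightarrow> integral\<^sup>L \<kappa> (indicator U)"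
      if "prob_space \<kappa>" "sets \<kappa> = sets borel" for \<kappa>
    proof -
      interpret prob_space \<kappa> by fact
      note [measurable_cong] = that(2)
      have [measurable]: "\<phi> n \<in> borel_measurable borel" for n
        by (rule borel_measurable_continuous_onI[OF cont])
      have [measurable]: "U \<in> sets borel" using U by simp
      show ?thesis
      proof (rule integral_dominated_convergence[where w = "\<lambda>_. 1"])
        show "AE x in \<kappa>. norm (\<phi> n x) \<le> 1" for n
          by (auto simp: \<phi>_def infdist_nonneg abs_le_iff intro!: order_trans[of _ 0 1])
      qed (use lim in auto)
    qed
    from this[OF assms(1) sets(1)] this[OF assms(2) sets(2)]
    have "integral\<^sup>L \<mu> (indicator U) = (integral\<^sup>L \<nu> (indicator U) :: real)"
      using eq[OF cont] by (intro LIMSEQ_unique) (auto simp: \<phi>_def infdist_nonneg)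
    then have "measure \<mu> U = measure \<nu> U"
      using U sets[THEN sets_eq_imp_space_eq] by simp
    then show ?thesis by (simp add: \<mu>.emeasure_eq_measure \<nu>.emeasure_eq_measure)
  qed
  show ?thesis
  proof (rule measure_eqI_generator_eq[where E = "Collect open" and \<Omega> = UNIV and A = "\<lambda>_. UNIV"])
    show "Int_stable (Collect open :: 'a set set)" by (auto simp: Int_stable_def)
    show "sets \<mu> = sigma_sets UNIV (Collect open)" "sets \<nu> = sigma_sets UNIV (Collect open)"
      by (simp_all add: sets borel_def)
  qed (auto simp: open_eq)
qed

text \<open>Almost sure limits are limits in law, and limits in law are unique; the two sequences
  may live on different probability spaces.\<close>

lemma distr_eq_of_AE_tendsto:
  fixes Y :: "nat \<Rightarrow> 'w \<Rightarrow> 'a::metric_space" and Y' :: "nat \<Rightarrow> 'v \<Rightarrow> 'a"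
  assumes "prob_space M" "prob_space M'"
    and Y[measurable]: "\<And>n. Y n \<in> borel_measurable M" and Y'[measurable]: "\<And>n. Y' n \<in> borel_measurable M'"
    and Z[measurable]: "Z \<in> borel_measurable M" and Z'[measurable]: "Z' \<in> borel_measurable M'"
    and eq: "\<And>n. distr M borel (Y n) = distr M' borel (Y' n)"
    and lim: "AE \<omega> in M. (\<lambda>n. Y n \<omega>) \<longlonglongrightarrow> Z \<omega>"
    and lim': "AE \<omega> in M'. (\<lambda>n. Y' n \<omega>) \<longlonglongrightarrow> Z' \<omega>"
  shows "distr M borel Z = distr M' borel Z'"
proof -
  interpret M: prob_space M by fact
  interpret M': prob_space M' by fact
  show ?thesis
  proof (rule borel_prob_eqI_bounded_continuous)
    fix \<phi> :: "'a \<Rightarrow> real"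
    assume \<phi>: "continuous_on UNIV \<phi>" "\<And>x. 0 \<le> \<phi> x" "\<And>x. \<phi> x \<le> 1"
    have [measurable]: "\<phi> \<in> borel_measurable borel"
      by (rule borel_measurable_continuous_onI[OF \<phi>(1)])
    have *: "(\<lambda>n. \<phi> (y n)) \<longlonglongrightarrow> \<phi> z" if "y \<longlonglongrightarrow> z" for y z
      using continuous_on_tendsto_compose[OF \<phi>(1) that] by simp
    have 1: "(\<lambda>n. \<integral>\<omega>. \<phi> (Y n \<omega>) \<partial>M) \<longlonglongrightarrow> (\<integral>\<omega>. \<phi> (Z \<omega>) \<partial>M)"
      by (rule integral_dominated_convergence[where w = "\<lambda>_. 1"]) (use \<phi>(2,3) lim in \<open>auto simp: * elim!: eventually_mono\<close>)
    have 2: "(\<lambda>n. \<integral>\<omega>. \<phi> (Y' n \<omega>) \<partial>M') \<longlonglongrightarrow> (\<integral>\<omega>. \<phi> (Z' \<omega>) \<partial>M')"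
      by (rule integral_dominated_convergence[where w = "\<lambda>_. 1"]) (use \<phi>(2,3) lim' in \<open>auto simp: * elim!: eventually_mono\<close>)
    have 3: "(\<integral>\<omega>. \<phi> (Y n \<omega>) \<partial>M) = (\<integral>\<omega>. \<phi> (Y' n \<omega>) \<partial>M')" for n
    proof -
      have "(\<integral>x. \<phi> x \<partial>distr M borel (Y n)) = (\<integral>x. \<phi> x \<partial>distr M' borel (Y' n))" by (simp add: eq)
      then show ?thesis by (simp add: integral_distr)
    qed
    from LIMSEQ_unique[OF 1 2[folded 3]]
    show "integral\<^sup>L (distr M borel Z) \<phi> = integral\<^sup>L (distr M' borel Z') \<phi>"
      by (simp add: integral_distr)
  qed (auto intro: M.prob_space_distr M'.prob_space_distr)
qed

text \<open>Realising both variables on the same space couples their laws at the constant distance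
  \<open>norm r\<close>.\<close>

lemma W2_shift_le:
  fixes Y :: "'w \<Rightarrow> 'a::euclidean_space"
  assumes "prob_space M" and Y[measurable]: "Y \<in> borel_measurable M"
  shows "W2 (distr M borel (\<lambda>\<omega>. Y \<omega> + r)) (distr M borel Y) \<le> ennreal (norm r)"
proof -
  interpret prob_space M by fact
  let ?\<mu> = "distr M borel (\<lambda>\<omega>. Y \<omega> + r)" and ?\<nu> = "distr M borel Y"
  let ?\<gamma> = "distr M (borel \<Otimes>\<^sub>M borel) (\<lambda>\<omega>. (Y \<omega> + r, Y \<omega>))"
  \<comment> \<open>\<open>couplings\<close> pushes forward into the marginals instead of
    \<open>borel\<close>; only the sigma-algebra of the target matters, so the two can be
    exchanged.\<close>
  have "distr ?\<gamma> ?\<mu> fst = ?\<mu>"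
    by (subst distr_cong[OF refl _ refl, of _ borel]) (simp_all add: distr_distr o_def)
  moreover have "distr ?\<gamma> ?\<nu> snd = ?\<nu>"
    by (subst distr_cong[OF refl _ refl, of _ borel]) (simp_all add: distr_distr o_def)
  moreover have "sets ?\<gamma> = sets (?\<mu> \<Otimes>\<^sub>M ?\<nu>)"
    by (simp cong: sets_pair_measure_cong)
  ultimately have \<gamma>: "?\<gamma> \<in> couplings ?\<mu> ?\<nu>" by (simp add: couplings_def)
  have "(\<integral>\<^sup>+ (x, y). ennreal ((norm (x - y))\<^sup>2) \<partial>?\<gamma>) = ennreal ((norm r)\<^sup>2)"
    by (subst nn_integral_distr) (auto simp: emeasure_space_1)
  then have "ennreal_sqrt (\<integral>\<^sup>+ (x, y). ennreal ((norm (x - y))\<^sup>2) \<partial>?\<gamma>) = ennreal (norm r)"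
    by (simp add: ennreal_sqrt_def)
  then show ?thesis unfolding W2_def by (metis (no_types, lifting) INF_lower \<gamma>)
qed

section \<open>Brownian increments as independent factors\<close>

context brownian_motion
begin

lemma measurable_F: "Y \<in> measurable (F t) N \<Longrightarrow> Y \<in> measurable M N"
  by (rule measurable_from_subalg[OF subalgebra_F])

lemma measurable_F_mono:
  assumes "s \<le> t" "Y \<in> measurable (F s) N"
  shows "Y \<in> measurable (F t) N"
  using assms sets_F_mono[OF assms(1)] space_F by (auto simp: measurable_def)

lemma measurable_B: "0 \<le> t \<Longrightarrow> B t \<in> borel_measurable M"
  using adapted measurable_F by blast

lemma distr_increment:
  assumes "0 \<le> s" "s < t"
  shows "distr M borel (\<lambda>\<omega>. B t \<omega> - B s \<omega>) =
    density lborel (\<lambda>x. ennreal (\<Prod>b\<in>Basis. normal_density 0 (sqrt (t - s)) (x \<bullet> b)))"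
proof -
  have "distr M borel (\<lambda>\<omega>. B t \<omega> - B s \<omega>) = distr M lborel (\<lambda>\<omega>. B t \<omega> - B s \<omega>)"
    by (rule distr_cong) auto
  then show ?thesis using distributed_distr_eq_density[OF increment_normal[OF assms]] by simp
qed

text \<open>Independence of the increment from \<open>F s\<close> factorises the joint law on
  rectangles, and these determine a product of sigma-finite measures.\<close>

lemma distr_pair_increment:
  assumes st: "0 \<le> s" "s < t" and Y: "Y \<in> measurable (F s) N"
  shows "distr M (N \<Otimes>\<^sub>M borel) (\<lambda>\<omega>. (Y \<omega>, B t \<omega> - B s \<omega>)) =
    distr M N Y \<Otimes>\<^sub>M distr M borel (\<lambda>\<omega>. B t \<omega> - B s \<omega>)"
proof -
  let ?D = "\<lambda>\<omega>. B t \<omega> - B s \<omega>"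
  have [measurable]: "?D \<in> borel_measurable M"
    using measurable_B st by auto
  have [measurable]: "Y \<in> measurable M N" by (rule measurable_F[OF Y])
  interpret PY: prob_space "distr M N Y" by (rule prob_space_distr) simp
  interpret PD: prob_space "distr M borel ?D" by (rule prob_space_distr) simp
  show ?thesis
  proof (rule pair_measure_eqI[symmetric])
    fix A C assume "A \<in> sets (distr M N Y)" "C \<in> sets (distr M borel ?D)"
    then have [measurable]: "A \<in> sets N" "C \<in> sets borel" by auto
    have "Y -` A \<inter> space M \<in> sets (F s)"
      using measurable_sets[OF Y, of A] by (simp add: space_F)
    moreover have "?D -` C \<inter> space M \<in> sets (vimage_algebra (space M) ?D borel)"
      by (rule in_vimage_algebra) simp
    ultimately have "prob ((Y -` A \<inter> space M) \<inter> (?D -` C \<inter> space M)) =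
        prob (Y -` A \<inter> space M) * prob (?D -` C \<inter> space M)"
      by (rule indep_setD[OF increment_indep[OF st]])
    moreover have "(Y -` A \<inter> space M) \<inter> (?D -` C \<inter> space M) = (\<lambda>\<omega>. (Y \<omega>, ?D \<omega>)) -` (A \<times> C) \<inter> space M"
      by auto
    ultimately show "emeasure (distr M N Y) A * emeasure (distr M borel ?D) C =
        emeasure (distr M (N \<Otimes>\<^sub>M borel) (\<lambda>\<omega>. (Y \<omega>, ?D \<omega>))) (A \<times> C)"
      by (simp add: emeasure_distr emeasure_eq_measure ennreal_mult')
  qed (auto intro: PY.sigma_finite_measure_axioms PD.sigma_finite_measure_axioms cong: sets_pair_measure_cong)
qed

end

text \<open>Pairing the sum with the current position \<open>V (\<tau> n)\<close> makes its law a function of its predecessor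
  and of the next, independent increment.\<close>

lemma brownian_sum_distr_eq:
  fixes B :: "real \<Rightarrow> 'w \<Rightarrow> 'a::euclidean_space" and B' :: "real \<Rightarrow> 'v \<Rightarrow> 'a"
    and \<delta> :: real and \<tau> :: "nat \<Rightarrow> real"
  assumes "brownian_motion M F B" "brownian_motion M' F' B'"
    and Y: "Y \<in> borel_measurable (F 0)" and Y': "Y' \<in> borel_measurable (F' 0)"
    and init: "distr M borel Y = distr M' borel Y'"
    and \<tau>: "\<tau> 0 = 0" "strict_mono \<tau>"
  defines "V \<equiv> \<lambda>s \<omega>. Y \<omega> + \<delta> *\<^sub>R B s \<omega>" and "V' \<equiv> \<lambda>s \<omega>. Y' \<omega> + \<delta> *\<^sub>R B' s \<omega>"
  shows "distr M (borel \<Otimes>\<^sub>M borel) (\<lambda>\<omega>. (\<Sum>k<n. c k *\<^sub>R V (\<tau> k) \<omega>, V (\<tau> n) \<omega>)) =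
    distr M' (borel \<Otimes>\<^sub>M borel) (\<lambda>\<omega>. (\<Sum>k<n. c k *\<^sub>R V' (\<tau> k) \<omega>, V' (\<tau> n) \<omega>))"
proof -
  have \<tau>_nonneg: "\<tau> k \<ge> 0" for k
    using monoD[OF strict_mono_mono[OF \<tau>(2)], of 0 k] \<tau>(1) by simp
  let ?S = "\<lambda>V n \<omega>. (\<Sum>k<n. c k *\<^sub>R V (\<tau> k) \<omega>, V (\<tau> n) \<omega>)"
  \<comment> \<open>One Markov step: the sum first takes in the current position with weight
    \<open>c n\<close>, and then the position moves by the scaled increment.\<close>
  define step where "step = (\<lambda>n ((a::'a, v), d::'a). (a + c n *\<^sub>R v, v + \<delta> *\<^sub>R d))"
  have step_meas [measurable]: "step n \<in> (borel \<Otimes>\<^sub>M borel) \<Otimes>\<^sub>M borel \<rightarrow>\<^sub>M borel \<Otimes>\<^sub>M borel" for n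
    unfolding step_def case_prod_beta by measurable
  \<comment> \<open>Apart from the law of the predecessor only a Gaussian density appears on the
    right, so both processes obey the same recursion in law. The space is kept generic to allow both
    instances.\<close>
  have recursion: "distr N (borel \<Otimes>\<^sub>M borel) (?S W (Suc n)) =
      distr (distr N (borel \<Otimes>\<^sub>M borel) (?S W n) \<Otimes>\<^sub>M
        density lborel (\<lambda>x. ennreal (\<Prod>b\<in>Basis. normal_density 0 (sqrt (\<tau> (Suc n) - \<tau> n)) (x \<bullet> b))))
        (borel \<Otimes>\<^sub>M borel) (step n)"
    if N: "brownian_motion N G b" and Z: "Z \<in> borel_measurable (G 0)" and W: "W = (\<lambda>s \<omega>. Z \<omega> + \<delta> *\<^sub>R b s \<omega>)"
    for N :: "'u measure" and G and b :: "real \<Rightarrow> 'u \<Rightarrow> 'a" and Z W n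
  proof -
    interpret N: brownian_motion N G b by fact
    have lt: "\<tau> n < \<tau> (Suc n)" using \<tau>(2) by (simp add: strict_mono_def)
    have W_meas: "W (\<tau> k) \<in> borel_measurable (G (\<tau> n))" if "k \<le> n" for k
    proof -
      have "\<tau> k \<le> \<tau> n" using that by (rule monoD[OF strict_mono_mono[OF \<tau>(2)]])
      then have "b (\<tau> k) \<in> borel_measurable (G (\<tau> n))"
        using N.measurable_F_mono N.adapted[OF \<tau>_nonneg] by blast
      moreover have "Z \<in> borel_measurable (G (\<tau> n))"
        using N.measurable_F_mono Z \<tau>_nonneg by blast
      ultimately show ?thesis unfolding W by (intro borel_measurable_add borel_measurable_scaleR) auto
    qed
    have S_meas: "?S W n \<in> G (\<tau> n) \<rightarrow>\<^sub>M borel \<Otimes>\<^sub>M borel"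
      by (intro measurable_Pair borel_measurable_sum borel_measurable_scaleR W_meas) auto
    have [measurable]: "?S W n \<in> N \<rightarrow>\<^sub>M borel \<Otimes>\<^sub>M borel" by (rule N.measurable_F[OF S_meas])
    have [measurable]: "(\<lambda>\<omega>. b (\<tau> (Suc n)) \<omega> - b (\<tau> n) \<omega>) \<in> borel_measurable N"
      using N.measurable_B \<tau>_nonneg by auto
    have "?S W (Suc n) = step n \<circ> (\<lambda>\<omega>. (?S W n \<omega>, b (\<tau> (Suc n)) \<omega> - b (\<tau> n) \<omega>))"
      by (auto simp: step_def W algebra_simps)
    then have "distr N (borel \<Otimes>\<^sub>M borel) (?S W (Suc n)) =
        distr (distr N ((borel \<Otimes>\<^sub>M borel) \<Otimes>\<^sub>M borel) (\<lambda>\<omega>. (?S W n \<omega>, b (\<tau> (Suc n)) \<omega> - b (\<tau> n) \<omega>)))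
          (borel \<Otimes>\<^sub>M borel) (step n)"
      by (simp add: distr_distr)
    then show ?thesis
      by (simp add: N.distr_pair_increment[OF \<tau>_nonneg lt S_meas] N.distr_increment[OF \<tau>_nonneg lt])
  qed
  have base: "distr N (borel \<Otimes>\<^sub>M borel) (?S W 0) =
      distr (distr N borel Z) (borel \<Otimes>\<^sub>M borel) (\<lambda>z. (0, z))"
    if N: "brownian_motion N G b" and Z: "Z \<in> borel_measurable (G 0)" and W: "W = (\<lambda>s \<omega>. Z \<omega> + \<delta> *\<^sub>R b s \<omega>)"
    for N :: "'u measure" and G and b :: "real \<Rightarrow> 'u \<Rightarrow> 'a" and Z W
  proof -
    interpret N: brownian_motion N G b by fact
    have [measurable]: "Z \<in> borel_measurable N" "b 0 \<in> borel_measurable N"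
      using N.measurable_F Z N.measurable_B by auto
    \<comment> \<open>\<open>b 0 = 0\<close> holds only almost surely, hence an almost-everywhere
      congruence.\<close>
    have "distr N (borel \<Otimes>\<^sub>M borel) (?S W 0) = distr N (borel \<Otimes>\<^sub>M borel) (\<lambda>\<omega>. (0, Z \<omega>))"
      using N.start_0 by (intro distr_cong_AE) (auto simp: W \<tau>(1))
    also have "\<dots> = distr (distr N borel Z) (borel \<Otimes>\<^sub>M borel) (\<lambda>z. (0, z))"
      by (simp add: distr_distr o_def)
    finally show ?thesis .
  qed
  show ?thesis
  proof (induction n)
    case 0
    show ?case
      using base[OF assms(1) Y refl] base[OF assms(2) Y' refl] init unfolding V_def V'_def by metis
  next
    case (Suc n)
    show ?case
      using recursion[OF assms(1) Y refl, of n] recursion[OF assms(2) Y' refl, of n] Suc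
      unfolding V_def V'_def by metis
  qed
qed

section \<open>Regularity of the consensus point\<close>

lemma expectation_bounded_continuous:
  fixes \<psi> :: "'a::metric_space \<Rightarrow> 'b::{banach, second_countable_topology}"
  assumes "prob_space M"
    and X: "\<And>t. t \<ge> 0 \<Longrightarrow> X t \<in> borel_measurable M"
    and paths: "AE \<omega> in M. continuous_on {0..} (\<lambda>t::real. X t \<omega>)"
    and \<psi>: "continuous_on UNIV \<psi>" and bound: "\<And>x. norm (\<psi> x) \<le> C"
  shows "continuous_on {0..} (\<lambda>t. \<integral>\<omega>. \<psi> (X t \<omega>) \<partial>M)"
proof (rule continuous_on_sequentiallyI)
  interpret prob_space M by fact
  fix u and a :: real
  assume u: "\<forall>n. u n \<in> {0..}" "a \<in> {0..}" "u \<longlonglongrightarrow> a"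
  have [measurable]: "X (u n) \<in> borel_measurable M" "X a \<in> borel_measurable M" for n
    using u X by auto
  have [measurable]: "\<psi> \<in> borel_measurable borel" by (rule borel_measurable_continuous_onI[OF \<psi>])
  show "(\<lambda>n. \<integral>\<omega>. \<psi> (X (u n) \<omega>) \<partial>M) \<longlonglongrightarrow> (\<integral>\<omega>. \<psi> (X a \<omega>) \<partial>M)"
  proof (rule integral_dominated_convergence[where w = "\<lambda>_. C"])
    show "AE \<omega> in M. (\<lambda>n. \<psi> (X (u n) \<omega>)) \<longlonglongrightarrow> \<psi> (X a \<omega>)"
      using paths
    proof eventually_elim
      case (elim \<omega>)
      have "(\<lambda>n. X (u n) \<omega>) \<longlonglongrightarrow> X a \<omega>"
        using continuous_on_tendsto_compose[OF elim u(3)] u by simp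
      then show ?case using continuous_on_tendsto_compose[OF \<psi>] by auto
    qed
  qed (use bound in auto)
qed

lemma consensus_point_distr:
  fixes Y :: "'w \<Rightarrow> 'a::euclidean_space"
  assumes f: "continuous_on UNIV f" and [measurable]: "Y \<in> borel_measurable M"
  shows "consensus_point f \<alpha> (distr M borel Y) =
    (\<integral>\<omega>. exp (- \<alpha> * f (Y \<omega>)) *\<^sub>R Y \<omega> \<partial>M) /\<^sub>R (\<integral>\<omega>. exp (- \<alpha> * f (Y \<omega>)) \<partial>M)"
proof -
  have [measurable]: "f \<in> borel_measurable borel" by (rule borel_measurable_continuous_onI[OF f])
  show ?thesis unfolding consensus_point_def by (simp add: integral_distr)
qed

text \<open>Since \<open>d \<le> c / 2\<close>, the perturbed denominator stays above
  \<open>c / 2\<close>; the difference then splits into a change of numerator and a change of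
  denominator.\<close>

lemma norm_quotient_diff_le:
  fixes N N0 :: "'a::real_normed_vector" and D D0 :: real
  assumes c: "c > 0" "c \<le> D0" "\<bar>D - D0\<bar> \<le> d" "d \<le> c / 2"
    and N: "norm (N - N0) \<le> d" "norm N0 \<le> C"
  shows "norm (N /\<^sub>R D - N0 /\<^sub>R D0) \<le> 2 / c * (1 + C / c) * d"
proof -
  have D: "D \<ge> c / 2" using c by linarith
  have d: "d \<ge> 0" using c by linarith
  have C: "C \<ge> 0" using N(2) norm_ge_zero[of N0] by linarith
  have D_inv: "inverse D \<le> 2 / c" "inverse D0 \<le> 1 / c"
    using c D by (simp_all add: field_simps)
  have pos: "D > 0" "D0 > 0" using c D by auto
  have "N /\<^sub>R D - N0 /\<^sub>R D0 = inverse D *\<^sub>R (N - N0) + (inverse D * inverse D0 * (D0 - D)) *\<^sub>R N0"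
    using pos by (simp add: algebra_simps)
  also have "norm \<dots> \<le> norm (inverse D *\<^sub>R (N - N0)) + norm ((inverse D * inverse D0 * (D0 - D)) *\<^sub>R N0)"
    by (rule norm_triangle_ineq)
  also have "norm (inverse D *\<^sub>R (N - N0)) \<le> 2 / c * d"
    unfolding norm_scaleR by (rule mult_mono) (use D_inv pos N c in auto)
  also have "norm ((inverse D * inverse D0 * (D0 - D)) *\<^sub>R N0) \<le> (2 / c * (1 / c) * d) * C"
    unfolding norm_scaleR
  proof (rule mult_mono)
    have "\<bar>inverse D * inverse D0 * (D0 - D)\<bar> = inverse D * inverse D0 * \<bar>D - D0\<bar>"
      using pos by (simp add: abs_mult abs_minus_commute)
    also have "\<dots> \<le> 2 / c * (1 / c) * d"
      using D_inv pos c by (intro mult_mono) auto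
    finally show "\<bar>inverse D * inverse D0 * (D0 - D)\<bar> \<le> 2 / c * (1 / c) * d" .
  qed (use N C c d in auto)
  finally show ?thesis by (simp add: algebra_simps add_divide_distrib)
qed

text \<open>Numerator and denominator are expectations of bounded continuous functions of
  \<open>X t\<close>, so dominated convergence along the paths makes them continuous; the
  denominator is positive as the mean of a positive variable.\<close>

lemma
  fixes f :: "'a::euclidean_space \<Rightarrow> real"
  assumes "prob_space M"
    and X: "\<And>t. t \<ge> 0 \<Longrightarrow> X t \<in> borel_measurable M"
    and paths: "AE \<omega> in M. continuous_on {0..} (\<lambda>t. X t \<omega>)"
    and f: "continuous_on UNIV f"
    and bound: "\<And>x. exp (- \<alpha> * f x) \<le> C" "\<And>x. norm (exp (- \<alpha> * f x) *\<^sub>R x) \<le> C"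
  shows consensus_weight_continuous: "continuous_on {0..} (\<lambda>t. \<integral>\<omega>. exp (- \<alpha> * f (X t \<omega>)) \<partial>M)"
    and consensus_weight_pos: "\<And>t. t \<ge> 0 \<Longrightarrow> 0 < (\<integral>\<omega>. exp (- \<alpha> * f (X t \<omega>)) \<partial>M)"
    and consensus_point_continuous: "continuous_on {0..} (\<lambda>t. consensus_point f \<alpha> (law M X t))"
proof -
  interpret prob_space M by fact
  have [measurable]: "f \<in> borel_measurable borel" by (rule borel_measurable_continuous_onI[OF f])
  show D: "continuous_on {0..} (\<lambda>t. \<integral>\<omega>. exp (- \<alpha> * f (X t \<omega>)) \<partial>M)"
    by (rule expectation_bounded_continuous[OF assms(1) X paths]) (use bound in \<open>auto intro!: continuous_intros f\<close>)
  show pos: "0 < (\<integral>\<omega>. exp (- \<alpha> * f (X t \<omega>)) \<partial>M)" if "t \<ge> 0" for t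
  proof (rule expectation_greater)
    have [measurable]: "X t \<in> borel_measurable M" using X that .
    show "integrable M (\<lambda>\<omega>. exp (- \<alpha> * f (X t \<omega>)))"
      by (rule integrable_const_bound[where B = C]) (use bound in auto)
  qed auto
  have N: "continuous_on {0..} (\<lambda>t. \<integral>\<omega>. exp (- \<alpha> * f (X t \<omega>)) *\<^sub>R X t \<omega> \<partial>M)"
    by (rule expectation_bounded_continuous[OF assms(1) X paths]) (use bound in \<open>auto intro!: continuous_intros f\<close>)
  have "continuous_on {0..} (\<lambda>t. (\<integral>\<omega>. exp (- \<alpha> * f (X t \<omega>)) *\<^sub>R X t \<omega> \<partial>M) /\<^sub>R
      (\<integral>\<omega>. exp (- \<alpha> * f (X t \<omega>)) \<partial>M))"
    by (intro continuous_intros D N) (use pos in fastforce)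
  then show "continuous_on {0..} (\<lambda>t. consensus_point f \<alpha> (law M X t))"
    unfolding law_def by (rule continuous_on_eq) (simp add: consensus_point_distr[OF f X])
qed

text \<open>A translation by \<open>y\<close> changes numerator and denominator by at most
  \<open>L * norm y\<close>. On the compact interval the denominator attains a positive minimum, so
  one constant serves all times.\<close>

lemma consensus_point_shift_lipschitz:
  fixes f :: "'a::euclidean_space \<Rightarrow> real"
  assumes "prob_space M"
    and X: "\<And>t. t \<ge> 0 \<Longrightarrow> X t \<in> borel_measurable M"
    and paths: "AE \<omega> in M. continuous_on {0..} (\<lambda>t. X t \<omega>)"
    and f: "continuous_on UNIV f"
    and bound: "\<And>x. exp (- \<alpha> * f x) \<le> C" "\<And>x. norm (exp (- \<alpha> * f x) *\<^sub>R x) \<le> C"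
    and L: "L > 0"
    and lip: "\<And>x y. \<bar>exp (- \<alpha> * f x) - exp (- \<alpha> * f y)\<bar> \<le> L * norm (x - y)"
      "\<And>x y. norm (exp (- \<alpha> * f x) *\<^sub>R x - exp (- \<alpha> * f y) *\<^sub>R y) \<le> L * norm (x - y)"
    and T: "T \<ge> 0"
  obtains L' \<epsilon> where "L' \<ge> 0" "\<epsilon> > 0"
    and "\<And>t y. t \<in> {0..T} \<Longrightarrow> norm y \<le> \<epsilon> \<Longrightarrow>
      norm (consensus_point f \<alpha> (distr M borel (\<lambda>\<omega>. X t \<omega> + y)) - consensus_point f \<alpha> (law M X t)) \<le> L' * norm y"
proof -
  interpret prob_space M by fact
  have [measurable]: "f \<in> borel_measurable borel" by (rule borel_measurable_continuous_onI[OF f])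
  let ?w = "\<lambda>x. exp (- \<alpha> * f x)"
  have C: "C \<ge> 0" using bound(1)[of 0] exp_ge_zero[of "- \<alpha> * f 0"] by linarith
  let ?D = "\<lambda>t. \<integral>\<omega>. ?w (X t \<omega>) \<partial>M"
  have "continuous_on {0..T} ?D"
    by (rule continuous_on_subset[OF consensus_weight_continuous[OF assms(1) X paths f bound]]) auto
  then obtain s where s: "s \<in> {0..T}" "\<And>t. t \<in> {0..T} \<Longrightarrow> ?D s \<le> ?D t"
    using continuous_attains_inf[OF compact_Icc, of 0 T ?D] T by auto
  define c where "c = ?D s"
  have c: "c > 0"
    unfolding c_def by (rule consensus_weight_pos[OF assms(1) X paths f bound]) (use s in auto)
  \<comment> \<open>This radius keeps \<open>L * norm y\<close> within \<open>c / 2\<close>, as the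
    quotient estimate requires; \<open>L'\<close> is the constant of that estimate times
    \<open>L\<close>.\<close>
  define \<epsilon> where "\<epsilon> = c / (2 * L)"
  define L' where "L' = 2 / c * (1 + C / c) * L"
  show ?thesis
  proof (rule that)
    show "\<epsilon> > 0" "L' \<ge> 0" using c L C by (auto simp: \<epsilon>_def L'_def)
    fix t and y :: 'a assume t: "t \<in> {0..T}" and y: "norm y \<le> \<epsilon>"
    have [measurable]: "X t \<in> borel_measurable M" using X t by auto
    have int: "integrable M (\<lambda>\<omega>. ?w (Y \<omega>))" "integrable M (\<lambda>\<omega>. ?w (Y \<omega>) *\<^sub>R Y \<omega>)"
      if [measurable]: "Y \<in> borel_measurable M" for Y
      by (rule integrable_const_bound[where B = C]; use bound in simp)+
    note int1 = int[of "X t"] and int2 = int[of "\<lambda>\<omega>. X t \<omega> + y"]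
    have dist_le: "norm ((\<integral>\<omega>. h (X t \<omega> + y) \<partial>M) - (\<integral>\<omega>. h (X t \<omega>) \<partial>M)) \<le> L * norm y"
      if "integrable M (\<lambda>\<omega>. h (X t \<omega> + y))" "integrable M (\<lambda>\<omega>. h (X t \<omega>))"
        "\<And>x y. norm (h x - h y) \<le> L * norm (x - y)"
      for h :: "'a \<Rightarrow> 'c::{banach, second_countable_topology}"
    proof -
      have shift: "norm (h (x + y) - h x) \<le> L * norm y" for x
        using that(3)[of "x + y" x] by simp
      have "norm (\<integral>\<omega>. h (X t \<omega> + y) - h (X t \<omega>) \<partial>M) \<le> (\<integral>\<omega>. L * norm y \<partial>M)"
        by (rule order_trans[OF integral_norm_bound integral_mono])
          (use that(1,2) shift in \<open>auto intro!: integrable_norm\<close>)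
      then show ?thesis using that(1,2) by (simp add: prob_space)
    qed
    have "norm (\<integral>\<omega>. ?w (X t \<omega>) *\<^sub>R X t \<omega> \<partial>M) \<le> (\<integral>\<omega>. C \<partial>M)"
      by (rule order_trans[OF integral_norm_bound integral_mono]) (use integrable_norm[OF int1(2)] bound in auto)
    then have N0: "norm (\<integral>\<omega>. ?w (X t \<omega>) *\<^sub>R X t \<omega> \<partial>M) \<le> C" by (simp add: prob_space)
    have "norm (consensus_point f \<alpha> (distr M borel (\<lambda>\<omega>. X t \<omega> + y)) - consensus_point f \<alpha> (law M X t))
        \<le> 2 / c * (1 + C / c) * (L * norm y)"
      unfolding law_def
    proof (subst (1 2) consensus_point_distr[OF f], simp, simp, rule norm_quotient_diff_le[OF c])
      show "c \<le> ?D t" using s t by (simp add: c_def)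
      show "L * norm y \<le> c / 2" using y L by (simp add: \<epsilon>_def field_simps)
      show "\<bar>(\<integral>\<omega>. ?w (X t \<omega> + y) \<partial>M) - ?D t\<bar> \<le> L * norm y"
        using dist_le[of ?w] int1 int2 lip by simp
      show "norm ((\<integral>\<omega>. ?w (X t \<omega> + y) *\<^sub>R (X t \<omega> + y) \<partial>M) - (\<integral>\<omega>. ?w (X t \<omega>) *\<^sub>R X t \<omega> \<partial>M)) \<le> L * norm y"
        using dist_le[of "\<lambda>x. ?w x *\<^sub>R x"] int1 int2 lip by simp
    qed (rule N0)
    then show "norm (consensus_point f \<alpha> (distr M borel (\<lambda>\<omega>. X t \<omega> + y)) - consensus_point f \<alpha> (law M X t))
        \<le> L' * norm y" by (simp add: L'_def mult.assoc)
  qed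
qed

section \<open>Linear equations with deterministic forcing\<close>

text \<open>The drift enters linearly, so subtracting a deterministic path \<open>g\<close> leaves an Ornstein--Uhlenbeck
  process that no longer depends on \<open>m\<close>.\<close>

lemma linear_sde_decomposition:
  fixes m :: "real \<Rightarrow> 'a::euclidean_space"
  assumes sde: "additive_sde_solution (\<lambda>t x. - c *\<^sub>R (x - m t)) \<delta> M F B X" and c: "c > 0"
  defines "V \<equiv> \<lambda>\<omega> t. X 0 \<omega> + \<delta> *\<^sub>R B t \<omega>"
  obtains g where "continuous_on {0..} g"
    and "\<And>t. t \<ge> 0 \<Longrightarrow> m integrable_on {0..t}"
    and "\<And>t. t \<ge> 0 \<Longrightarrow> g t = c *\<^sub>R (integral {0..t} m - integral {0..t} g)"
    and "AE \<omega> in M. continuous_on {0..} (V \<omega>) \<and>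
      (\<forall>t\<ge>0. X t \<omega> - g t = V \<omega> t - c *\<^sub>R integral {0..t} (\<lambda>s. exp (- c * (t - s)) *\<^sub>R V \<omega> s))"
proof -
  interpret brownian_motion M F B using sde by (simp add: additive_sde_solution_def)
  have paths: "AE \<omega> in M. continuous_on {0..} (\<lambda>t. X t \<omega>)"
    and eqn: "AE \<omega> in M. \<forall>t\<ge>0. set_integrable lborel {0..t} (\<lambda>s. - c *\<^sub>R (X s \<omega> - m s)) \<and>
      X t \<omega> = X 0 \<omega> + (LINT s:{0..t}|lborel. - c *\<^sub>R (X s \<omega> - m s)) + \<delta> *\<^sub>R B t \<omega>"
    using sde by (auto simp: additive_sde_solution_def)
  have X_int: "(\<lambda>s. X s \<omega>) integrable_on {0..t}" if "continuous_on {0..} (\<lambda>t. X t \<omega>)" for \<omega> t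
    by (intro integrable_continuous_real continuous_on_subset[OF that]) auto
  have int': "m integrable_on {0..t}" if cont: "continuous_on {0..} (\<lambda>t. X t \<omega>)"
    and "set_integrable lborel {0..t} (\<lambda>s. - c *\<^sub>R (X s \<omega> - m s))" for \<omega> t
  proof -
    \<comment> \<open>Integrability of \<open>m\<close> is read off from the drift: \<open>m\<close>
      is the path plus the drift divided by \<open>c\<close>.\<close>
    have "(\<lambda>s. X s \<omega> - (- (1 / c)) *\<^sub>R (- c *\<^sub>R (X s \<omega> - m s))) integrable_on {0..t}"
      by (intro integrable_diff X_int[OF cont] integrable_cmul set_borel_integral_eq_integral(1)[OF that(2)])
    then show ?thesis using c by simp
  qed
  have "AE \<omega> in M. \<forall>t\<ge>0. m integrable_on {0..t}"
    using paths eqn by eventually_elim (use int' in blast)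
  \<comment> \<open>The statement does not involve \<omega>, so holding almost surely on a
    probability space it holds outright.\<close>
  then have int: "m integrable_on {0..t}" if "t \<ge> 0" for t
    using that AE_False by (cases "\<forall>t\<ge>0. m integrable_on {0..t}") auto
  have "continuous_on {0..} (\<lambda>t. c *\<^sub>R integral {0..t} m)"
    by (intro continuous_intros continuous_on_atLeastI indefinite_integral_continuous_1 int)
  \<comment> \<open>\<open>g\<close> is the response to \<open>m\<close> of the equation without
    noise, started at 0.\<close>
  then obtain g where g: "continuous_on {0..} g"
    and g_eq: "\<And>t. t \<ge> 0 \<Longrightarrow> c *\<^sub>R integral {0..t} m = g t + c *\<^sub>R integral {0..t} g"
    using volterra_exists[of "\<lambda>t. c *\<^sub>R integral {0..t} m" c] by blast
  have g_int: "g integrable_on {0..t}" for t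
    by (intro integrable_continuous_real continuous_on_subset[OF g]) auto
  show ?thesis
  proof (rule that[OF g int])
    show "g t = c *\<^sub>R (integral {0..t} m - integral {0..t} g)" if "t \<ge> 0" for t
      using g_eq[OF that] by (simp add: algebra_simps)
    show "AE \<omega> in M. continuous_on {0..} (V \<omega>) \<and>
      (\<forall>t\<ge>0. X t \<omega> - g t = V \<omega> t - c *\<^sub>R integral {0..t} (\<lambda>s. exp (- c * (t - s)) *\<^sub>R V \<omega> s))"
      using paths eqn continuous_paths
    proof eventually_elim
      case (elim \<omega>)
      \<comment> \<open>Subtracting the equation of \<open>g\<close> cancels \<open>m\<close>; what
        remains is a Volterra equation for \<open>X - g\<close> with the continuous input
        \<open>V\<close>.\<close>
      have V_eq: "V \<omega> s = (X s \<omega> - g s) + c *\<^sub>R integral {0..s} (\<lambda>s. X s \<omega> - g s)" if s: "s \<ge> 0" for s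
      proof -
        have "(LINT s:{0..s}|lborel. - c *\<^sub>R (X s \<omega> - m s)) = integral {0..s} (\<lambda>s. - c *\<^sub>R (X s \<omega> - m s))"
          by (rule set_borel_integral_eq_integral(2)) (rule conjunct1[OF elim(2)[rule_format, OF s]])
        also have "\<dots> = - c *\<^sub>R (integral {0..s} (\<lambda>s. X s \<omega>) - integral {0..s} m)"
          by (subst integral_cmul, subst integral_diff[OF X_int[OF elim(1)] int[OF s]]) (rule refl)
        finally have X_eq: "X s \<omega> = V \<omega> s - c *\<^sub>R integral {0..s} (\<lambda>s. X s \<omega>) + c *\<^sub>R integral {0..s} m"
          using conjunct2[OF elim(2)[rule_format, OF s]] by (simp add: V_def algebra_simps)
        have diff: "integral {0..s} (\<lambda>s. X s \<omega> - g s) = integral {0..s} (\<lambda>s. X s \<omega>) - integral {0..s} g"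
          by (rule integral_diff[OF X_int[OF elim(1)] g_int])
        show ?thesis unfolding diff using X_eq g_eq[OF s] by (simp add: algebra_simps)
      qed
      have "X t \<omega> - g t = V \<omega> t - c *\<^sub>R integral {0..t} (\<lambda>s. exp (- c * (t - s)) *\<^sub>R V \<omega> s)" if "t \<ge> 0" for t
        by (rule volterra_solution[where x = "\<lambda>t. X t \<omega> - g t", OF _ that V_eq])
          (intro continuous_intros elim(1) g)
      moreover have "continuous_on {0..} (V \<omega>)"
        unfolding V_def by (intro continuous_intros elim(3))
      ultimately show ?case by blast
    qed
  qed
qed

text \<open>After removal of their deterministic parts \<open>g\<close> and \<open>g'\<close>, both
  solutions are the same functional of initial value plus noise. Its discretisations agree in law,
  hence so do the limits, and the offset is \<open>g' - g\<close>.\<close>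

lemma linear_sde_law_shift:
  fixes m m' :: "real \<Rightarrow> 'a::euclidean_space"
    and X :: "real \<Rightarrow> 'w \<Rightarrow> 'a" and X' :: "real \<Rightarrow> 'v \<Rightarrow> 'a"
  assumes sde: "additive_sde_solution (\<lambda>t x. - c *\<^sub>R (x - m t)) \<delta> M F B X"
    and sde': "additive_sde_solution (\<lambda>t x. - c *\<^sub>R (x - m' t)) \<delta> M' F' B' X'"
    and init: "law M X 0 = law M' X' 0" and c: "c > 0"
  obtains r where "continuous_on {0..} r"
    and "\<And>t. t \<ge> 0 \<Longrightarrow> m integrable_on {0..t}" and "\<And>t. t \<ge> 0 \<Longrightarrow> m' integrable_on {0..t}"
    and "\<And>t. t \<ge> 0 \<Longrightarrow> r t = c *\<^sub>R (integral {0..t} m' - integral {0..t} m - integral {0..t} r)"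
    and "\<And>t. t \<ge> 0 \<Longrightarrow> law M' X' t = distr M borel (\<lambda>\<omega>. X t \<omega> + r t)"
proof -
  interpret M: brownian_motion M F B using sde by (simp add: additive_sde_solution_def)
  interpret M': brownian_motion M' F' B' using sde' by (simp add: additive_sde_solution_def)
  have X_F: "t \<ge> 0 \<Longrightarrow> X t \<in> borel_measurable (F t)" for t
    using sde by (simp add: additive_sde_solution_def)
  have X'_F: "t \<ge> 0 \<Longrightarrow> X' t \<in> borel_measurable (F' t)" for t
    using sde' by (simp add: additive_sde_solution_def)
  define V where "V = (\<lambda>\<omega> t. X 0 \<omega> + \<delta> *\<^sub>R B t \<omega>)"
  define V' where "V' = (\<lambda>\<omega> t. X' 0 \<omega> + \<delta> *\<^sub>R B' t \<omega>)"
  \<comment> \<open>\<open>J t\<close> maps the input path to the Ornstein--Uhlenbeck value at time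
    \<open>t\<close>.\<close>
  define J where "J = (\<lambda>t (v :: real \<Rightarrow> 'a). v t - c *\<^sub>R integral {0..t} (\<lambda>s. exp (- c * (t - s)) *\<^sub>R v s))"
  obtain g where g: "continuous_on {0..} g" "\<And>t. t \<ge> 0 \<Longrightarrow> m integrable_on {0..t}"
    "\<And>t. t \<ge> 0 \<Longrightarrow> g t = c *\<^sub>R (integral {0..t} m - integral {0..t} g)"
    "AE \<omega> in M. continuous_on {0..} (\<lambda>t. X 0 \<omega> + \<delta> *\<^sub>R B t \<omega>) \<and> (\<forall>t\<ge>0. X t \<omega> - g t =
      X 0 \<omega> + \<delta> *\<^sub>R B t \<omega> -
      c *\<^sub>R integral {0..t} (\<lambda>s. exp (- c * (t - s)) *\<^sub>R (X 0 \<omega> + \<delta> *\<^sub>R B s \<omega>)))"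
    by (rule linear_sde_decomposition[OF sde c]) (rule that)
  have OU: "AE \<omega> in M. continuous_on {0..} (V \<omega>) \<and> (\<forall>t\<ge>0. X t \<omega> - g t = J t (V \<omega>))"
    using g(4) by (simp only: V_def J_def)
  obtain g' where g': "continuous_on {0..} g'" "\<And>t. t \<ge> 0 \<Longrightarrow> m' integrable_on {0..t}"
    "\<And>t. t \<ge> 0 \<Longrightarrow> g' t = c *\<^sub>R (integral {0..t} m' - integral {0..t} g')"
    "AE \<omega> in M'. continuous_on {0..} (\<lambda>t. X' 0 \<omega> + \<delta> *\<^sub>R B' t \<omega>) \<and> (\<forall>t\<ge>0. X' t \<omega> - g' t =
      X' 0 \<omega> + \<delta> *\<^sub>R B' t \<omega> -
      c *\<^sub>R integral {0..t} (\<lambda>s. exp (- c * (t - s)) *\<^sub>R (X' 0 \<omega> + \<delta> *\<^sub>R B' s \<omega>)))"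
    by (rule linear_sde_decomposition[OF sde' c]) (rule that)
  have OU': "AE \<omega> in M'. continuous_on {0..} (V' \<omega>) \<and> (\<forall>t\<ge>0. X' t \<omega> - g' t = J t (V' \<omega>))"
    using g'(4) by (simp only: V'_def J_def)
  have [measurable]: "X t \<in> borel_measurable M" "X' t \<in> borel_measurable M'" if "t \<ge> 0" for t
    using that X_F X'_F M.measurable_F M'.measurable_F by blast+
  have [measurable]: "B t \<in> borel_measurable M" "B' t \<in> borel_measurable M'" if "t \<ge> 0" for t
    using that M.measurable_B M'.measurable_B by blast+
  have V_meas [measurable]: "(\<lambda>\<omega>. V \<omega> t) \<in> borel_measurable M" "(\<lambda>\<omega>. V' \<omega> t) \<in> borel_measurable M'"
    if "t \<ge> 0" for t
    unfolding V_def V'_def using that by measurable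
  \<comment> \<open>Positivity of \<open>t\<close> makes the time grid strictly increasing; time 0
    is settled by the common initial law.\<close>
  have OU_eq: "distr M borel (\<lambda>\<omega>. X t \<omega> - g t) = distr M' borel (\<lambda>\<omega>. X' t \<omega> - g' t)" if t: "t > 0" for t
  proof -
    have [measurable]: "X t \<in> borel_measurable M" "X' t \<in> borel_measurable M'"
      using t by simp_all
    define h where "h = (\<lambda>n. t / real (Suc n))"
    \<comment> \<open>The last summand is \<open>v t\<close>. It is kept outside the sum so that
      \<open>S\<close> adds the two components of the pair treated in
      \<open>brownian_sum_distr_eq\<close>.\<close>
    define S where "S = (\<lambda>n (v :: real \<Rightarrow> 'a).
      (\<Sum>k<Suc n. (- c * h n * exp (- c * (t - real k * h n))) *\<^sub>R v (real k * h n)) + v (real (Suc n) * h n))"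
    have h: "h n > 0" for n using t by (simp add: h_def)
    have S_lim: "(\<lambda>n. S n v) \<longlonglongrightarrow> J t v" if v: "continuous_on {0..} v" for v
    proof -
      have "(\<lambda>n. \<Sum>k<Suc n. h n *\<^sub>R (exp (- c * (t - real k * h n)) *\<^sub>R v (real k * h n))) \<longlonglongrightarrow>
          integral {0..t} (\<lambda>s. exp (- c * (t - s)) *\<^sub>R v s)"
        unfolding h_def using t
        by (intro riemann_sums_tendsto continuous_intros continuous_on_subset[OF v]) auto
      then have "(\<lambda>n. v t - c *\<^sub>R (\<Sum>k<Suc n. h n *\<^sub>R (exp (- c * (t - real k * h n)) *\<^sub>R v (real k * h n)))) \<longlonglongrightarrow> J t v"
        unfolding J_def by (intro tendsto_intros)
      moreover have "S n v = v t - c *\<^sub>R (\<Sum>k<Suc n. h n *\<^sub>R (exp (- c * (t - real k * h n)) *\<^sub>R v (real k * h n)))" for n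
      proof -
        have "real (Suc n) * h n = t" by (simp add: h_def)
        then show ?thesis
          by (simp add: S_def scaleR_sum_right mult.assoc sum_negf del: sum.lessThan_Suc of_nat_Suc)
      qed
      ultimately show ?thesis by simp
    qed
    have S_distr: "distr M borel (\<lambda>\<omega>. S n (V \<omega>)) = distr M' borel (\<lambda>\<omega>. S n (V' \<omega>))" for n
    proof -
      let ?\<tau> = "\<lambda>k. real k * h n" and ?c = "\<lambda>k. - c * h n * exp (- c * (t - real k * h n))"
      let ?P = "\<lambda>v. (\<Sum>k<Suc n. ?c k *\<^sub>R v (?\<tau> k), v (?\<tau> (Suc n)))"
      have nonneg: "?\<tau> k \<ge> 0" for k using h[of n] by simp
      have "distr M (borel \<Otimes>\<^sub>M borel) (\<lambda>\<omega>. ?P (V \<omega>)) = distr M' (borel \<Otimes>\<^sub>M borel) (\<lambda>\<omega>. ?P (V' \<omega>))"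
        unfolding V_def V'_def
        by (rule brownian_sum_distr_eq[OF M.brownian_motion_axioms M'.brownian_motion_axioms X_F X'_F])
          (use init h in \<open>auto simp: law_def strict_mono_def\<close>)
      then have eq: "distr (distr M (borel \<Otimes>\<^sub>M borel) (\<lambda>\<omega>. ?P (V \<omega>))) borel (\<lambda>(a, b). a + b) =
          distr (distr M' (borel \<Otimes>\<^sub>M borel) (\<lambda>\<omega>. ?P (V' \<omega>))) borel (\<lambda>(a, b). a + b)" by (rule arg_cong)
      have "(\<lambda>\<omega>. ?P (V \<omega>)) \<in> M \<rightarrow>\<^sub>M borel \<Otimes>\<^sub>M borel" "(\<lambda>\<omega>. ?P (V' \<omega>)) \<in> M' \<rightarrow>\<^sub>M borel \<Otimes>\<^sub>M borel"
        by (intro measurable_Pair borel_measurable_sum borel_measurable_scaleR borel_measurable_const V_meas nonneg)+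
      then show ?thesis
        using eq by (simp add: distr_distr case_prod_beta' o_def S_def del: sum.lessThan_Suc of_nat_Suc)
    qed
    have S_meas: "(\<lambda>\<omega>. S n (V \<omega>)) \<in> borel_measurable M" "(\<lambda>\<omega>. S n (V' \<omega>)) \<in> borel_measurable M'" for n
      unfolding S_def using h[of n]
      by (intro borel_measurable_add borel_measurable_sum borel_measurable_scaleR borel_measurable_const V_meas; simp)+
    show ?thesis
    proof (rule distr_eq_of_AE_tendsto[OF M.prob_space_axioms M'.prob_space_axioms S_meas _ _ S_distr])
      show "AE \<omega> in M. (\<lambda>n. S n (V \<omega>)) \<longlonglongrightarrow> X t \<omega> - g t"
        using OU by eventually_elim (use S_lim t in auto)
      show "AE \<omega> in M'. (\<lambda>n. S n (V' \<omega>)) \<longlonglongrightarrow> X' t \<omega> - g' t"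
        using OU' by eventually_elim (use S_lim t in auto)
    qed measurable
  qed
  define r where "r = (\<lambda>t. g' t - g t)"
  show ?thesis
  proof (rule that[OF _ g(2) g'(2)])
    show "continuous_on {0..} r" unfolding r_def by (intro continuous_intros g g')
    show "r t = c *\<^sub>R (integral {0..t} m' - integral {0..t} m - integral {0..t} r)" if t: "t \<ge> 0" for t
    proof -
      have r_int: "integral {0..t} r = integral {0..t} g' - integral {0..t} g"
        unfolding r_def by (intro integral_diff integrable_continuous_real continuous_on_subset[OF g(1)]
          continuous_on_subset[OF g'(1)]) auto
      have "c *\<^sub>R integral {0..t} m = g t + c *\<^sub>R integral {0..t} g"
        "c *\<^sub>R integral {0..t} m' = g' t + c *\<^sub>R integral {0..t} g'"
        using g(3)[OF t] g'(3)[OF t] by (simp_all add: algebra_simps)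
      then show ?thesis unfolding r_int by (simp add: r_def scaleR_diff_right)
    qed
    show "law M' X' t = distr M borel (\<lambda>\<omega>. X t \<omega> + r t)" if t: "t \<ge> 0" for t
    proof (cases "t = 0")
      case True
      \<comment> \<open>Integrals over a single point vanish, so \<open>g\<close> and
        \<open>g'\<close> both start at 0.\<close>
      then show ?thesis using init g(3)[of 0] g'(3)[of 0] by (simp add: r_def law_def)
    next
      case False
      have [measurable]: "X t \<in> borel_measurable M" "X' t \<in> borel_measurable M'" using t by simp_all
      have "law M' X' t = distr (distr M' borel (\<lambda>\<omega>. X' t \<omega> - g' t)) borel (\<lambda>x. x + g' t)"
        by (simp add: distr_distr o_def law_def)
      also have "distr M' borel (\<lambda>\<omega>. X' t \<omega> - g' t) = distr M borel (\<lambda>\<omega>. X t \<omega> - g t)"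
        using OU_eq[of t] t False by simp
      also have "distr \<dots> borel (\<lambda>x. x + g' t) = distr M borel (\<lambda>\<omega>. X t \<omega> + r t)"
        by (simp add: distr_distr o_def r_def algebra_simps)
      finally show ?thesis .
    qed
  qed
qed

section \<open>Convergence\<close>

lemma grid_time_bounds:
  assumes "h > 0" "t \<ge> 0"
  shows "0 \<le> grid_time h t" "grid_time h t \<le> t" "t - grid_time h t < h"
proof -
  have "of_int \<lfloor>t / h\<rfloor> \<le> t / h" "t / h < of_int \<lfloor>t / h\<rfloor> + 1" by linarith+
  then have "of_int \<lfloor>t / h\<rfloor> * h \<le> t" "t < (of_int \<lfloor>t / h\<rfloor> + 1) * h"
    using assms(1) by (simp_all only: pos_le_divide_eq pos_divide_less_eq)
  then show "grid_time h t \<le> t" "t - grid_time h t < h"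
    by (simp_all add: grid_time_def algebra_simps)
  show "0 \<le> grid_time h t" using assms by (simp add: grid_time_def)
qed

text \<open>Here \<open>m\<close> and \<open>m'\<close> are the consensus points of the two schemes and \<open>r\<close> is the
  deterministic offset between them; freezing costs only the oscillation \<open>w\<close> of \<open>m\<close> over one step.\<close>

lemma frozen_shift_bound:
  fixes m :: "real \<Rightarrow> 'a::euclidean_space" and m' r :: "real \<Rightarrow> 'a"
  assumes h: "h > 0" and c: "c > 0" and T: "T > 0" and L': "L' \<ge> 0"
    and r: "continuous_on {0..} r"
    and m_int: "\<And>t. t \<ge> 0 \<Longrightarrow> m integrable_on {0..t}"
    and m'_int: "\<And>t. t \<ge> 0 \<Longrightarrow> m' integrable_on {0..t}"
    and r_eq: "\<And>t. t \<ge> 0 \<Longrightarrow> r t = c *\<^sub>R (integral {0..t} m' - integral {0..t} m - integral {0..t} r)"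
    and lip: "\<And>s. s \<in> {0..T} \<Longrightarrow> norm (r (grid_time h s)) \<le> \<epsilon> \<Longrightarrow>
      norm (m' s - m (grid_time h s)) \<le> L' * norm (r (grid_time h s))"
    and modulus: "\<And>s u. s \<in> {0..T} \<Longrightarrow> u \<in> {0..T} \<Longrightarrow> \<bar>s - u\<bar> < h \<Longrightarrow> norm (m s - m u) \<le> w"
    and \<eta>: "\<eta> > 0" "\<eta> * exp (c * (L' + 1) * T) \<le> \<epsilon>" "c * T * w < \<eta>"
    and t: "t \<in> {0..T}"
  shows "norm (r t) < \<eta> * exp (c * (L' + 1) * t)"
proof (rule gronwall_bootstrap[where e = "\<lambda>t. norm (r t)" and A = "c * T * w" and T = T])
  let ?E = "\<lambda>s. \<eta> * exp (c * (L' + 1) * s)"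
  show "continuous_on {0..T} (\<lambda>t. norm (r t))"
    by (intro continuous_intros continuous_on_subset[OF r]) auto
  show "0 < c * (L' + 1)" using c L' by simp
  show "norm (r 0) < \<eta>" using r_eq[of 0] \<eta> by simp
  have w: "w \<ge> 0" using modulus[of 0 0] h T by simp
  fix t assume t: "0 < t" "t \<le> T" and below: "\<And>s. 0 \<le> s \<Longrightarrow> s < t \<Longrightarrow> norm (r s) < ?E s"
  have r_int: "r integrable_on {0..t}"
    by (intro integrable_continuous_real continuous_on_subset[OF r]) auto
  have int: "(\<lambda>s. m' s - m s - r s) integrable_on {0..t}"
    using t by (intro integrable_diff m_int m'_int r_int) auto
  have E_int: "?E integrable_on {0..t}"
    by (intro integrable_continuous_real continuous_intros)
  \<comment> \<open>The bootstrap hypothesis is available only before \<open>t\<close>, so the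
    endpoint is excluded here and its value is replaced by 0 under the integral.\<close>
  have bound: "norm (m' s - m s - r s) \<le> w + (L' + 1) * ?E s" if s: "s \<in> {0..t}" "s \<noteq> t" for s
  proof -
    have s': "0 \<le> s" "s < t" using s by auto
    define u where "u = grid_time h s"
    have u: "0 \<le> u" "u \<le> s" "s - u < h" using grid_time_bounds[OF h s'(1)] by (auto simp: u_def)
    have E_mono: "?E a \<le> ?E b" if "a \<le> b" for a b
      using that \<eta>(1) c L' by (intro mult_left_mono) auto
    have ru: "norm (r u) \<le> ?E s" using below[of u] E_mono[OF u(2)] u s' by simp
    then have "norm (r u) \<le> \<epsilon>" using E_mono[of s T] \<eta>(2) s' t by simp
    then have "norm (m' s - m u) \<le> L' * norm (r u)" using lip[of s] s' t by (simp add: u_def)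
    also have "\<dots> \<le> L' * ?E s" using ru L' by (intro mult_left_mono)
    finally have 1: "norm (m' s - m u) \<le> L' * ?E s" .
    have 2: "norm (m u - m s) \<le> w" using modulus[of u s] u s' t by simp
    have 3: "norm (r s) \<le> ?E s" using below[of s] s' by simp
    have "m' s - m s - r s = (m' s - m u) + (m u - m s) - r s" by simp
    also have "norm \<dots> \<le> norm (m' s - m u) + norm (m u - m s) + norm (r s)"
      by (meson add_right_mono norm_triangle_ineq norm_triangle_ineq4 order_trans)
    finally show ?thesis using 1 2 3 by (simp add: algebra_simps)
  qed
  have "norm (r t) = c * norm (integral {0..t} (\<lambda>s. m' s - m s - r s))"
    using t c r_eq[of t] by (simp add: integral_diff integrable_diff m_int m'_int r_int)
  also have "integral {0..t} (\<lambda>s. m' s - m s - r s) =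
      integral {0..t} (\<lambda>s. if s = t then 0 else m' s - m s - r s)"
    by (rule integral_spike[of "{t}"]) auto
  also have "norm \<dots> \<le> integral {0..t} (\<lambda>s. w + (L' + 1) * ?E s)"
  proof (rule integral_norm_bound_integral)
    show "(\<lambda>s. if s = t then 0 else m' s - m s - r s) integrable_on {0..t}"
      by (rule integrable_spike[OF int, of "{t}"]) auto
    show "(\<lambda>s. w + (L' + 1) * ?E s) integrable_on {0..t}"
      by (intro integrable_continuous_real continuous_intros)
    show "norm (if s = t then 0 else m' s - m s - r s) \<le> w + (L' + 1) * ?E s" if "s \<in> {0..t}" for s
      using bound[OF that] w L' \<eta>(1) by auto
  qed
  also have "\<dots> = t * w + (L' + 1) * integral {0..t} ?E"
    using t integral_unique[OF has_integral_add[OF has_integral_const_real[of w 0 t]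
      has_integral_mult_right[OF integrable_integral[OF E_int], of "L' + 1"]]] by simp
  finally have "norm (r t) \<le> c * (t * w + (L' + 1) * integral {0..t} ?E)" using c by simp
  also have "\<dots> \<le> c * (T * w + (L' + 1) * integral {0..t} ?E)"
    using t w c by simp (intro mult_right_mono; simp)
  finally show "norm (r t) \<le> c * T * w + c * (L' + 1) * integral {0..t} ?E"
    by (simp add: algebra_simps)
qed (use \<eta> t in auto)

theorem theorem3p23:
  fixes f :: "'a::euclidean_space \<Rightarrow> real"
    and xstar :: 'a
    and Lf cl cu K lam \<delta> \<alpha> T :: real
    and \<rho>0 :: "'a measure"
    and M :: "'w measure" and F :: "real \<Rightarrow> 'w measure" and B X :: "real \<Rightarrow> 'w \<Rightarrow> 'a"
    and M' :: "real \<Rightarrow> 'v measure" and F' :: "real \<Rightarrow> real \<Rightarrow> 'v measure"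
    and B' X' :: "real \<Rightarrow> real \<Rightarrow> 'v \<Rightarrow> 'a"
  assumes f_cont: "continuous_on UNIV f"
    and f_min: "\<And>x. f xstar \<le> f x"
    and f_min_unique: "\<And>x. f x = f xstar \<Longrightarrow> x = xstar"
    and Lf_pos: "Lf > 0"
    and f_lipschitz: "\<And>x y. \<bar>f x - f y\<bar> \<le> Lf * (1 + norm x + norm y) * norm (x - y)"
    and growth_pos: "cl > 0" "cu > 0" "K > 0"
    and f_upper: "\<And>x. f x - f xstar \<le> cu * ((norm x)\<^sup>2 + 1)"
    and f_lower: "\<And>x. norm x \<ge> K \<Longrightarrow> cl * (norm x)\<^sup>2 \<le> f x - f xstar"
    and lam_pos: "lam > 0" and delta_pos: "\<delta> > 0" and alpha_pos: "\<alpha> > 0"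
    and init: "\<rho>0 \<in> P4"
    and cbo: "delta_cbo_solution f lam \<delta> \<alpha> \<rho>0 M F B X"
    and freezing: "\<And>h. h > 0 \<Longrightarrow>
      consensus_freezing_solution f lam \<delta> \<alpha> h \<rho>0 (M' h) (F' h) (B' h) (X' h)"
    and T_pos: "T > 0"
  shows "((\<lambda>h. SUP t\<in>{0..T}. W2 (law (M' h) (X' h) t) (law M X t)) \<longlongrightarrow> 0) (at_right 0)"
proof -
  have sde: "additive_sde_solution
      (\<lambda>t x. - lam *\<^sub>R (x - consensus_point f \<alpha> (law M X t))) \<delta> M F B X"
    and law0: "law M X 0 = \<rho>0"
    using cbo by (auto simp: delta_cbo_solution_def)
  interpret brownian_motion M F B using sde by (simp add: additive_sde_solution_def)
  have X: "X t \<in> borel_measurable M" if "t \<ge> 0" for t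
    using sde that measurable_F by (auto simp: additive_sde_solution_def)
  have paths: "AE \<omega> in M. continuous_on {0..} (\<lambda>t. X t \<omega>)"
    using sde by (simp add: additive_sde_solution_def)
  obtain C where C: "\<And>x. (1 + norm x) ^ 3 * exp (- \<alpha> * f x) \<le> C"
    using gibbs_weight_decay[OF f_min growth_pos(1) f_lower alpha_pos] by blast
  have p_ge: "1 \<le> (1 + norm x) ^ 3" "norm x \<le> (1 + norm x) ^ 3" for x :: 'a
    using self_le_power[of "1 + norm x" 3] by auto
  have bound: "exp (- \<alpha> * f x) \<le> C" "norm (exp (- \<alpha> * f x) *\<^sub>R x) \<le> C" for x
    using mult_right_mono[OF p_ge(1)[of x], of "exp (- \<alpha> * f x)", THEN order_trans, OF _ C[of x]]
      mult_right_mono[OF p_ge(2)[of x], of "exp (- \<alpha> * f x)", THEN order_trans, OF _ C[of x]]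
    by (simp_all add: mult.commute)
  obtain L where L: "L > 0"
    "\<And>x y. \<bar>exp (- \<alpha> * f x) - exp (- \<alpha> * f y)\<bar> \<le> L * norm (x - y)"
    "\<And>x y. norm (exp (- \<alpha> * f x) *\<^sub>R x - exp (- \<alpha> * f y) *\<^sub>R y) \<le> L * norm (x - y)"
    using gibbs_weight_lipschitz[OF C Lf_pos alpha_pos f_lipschitz] by blast
  define m where "m = (\<lambda>t. consensus_point f \<alpha> (law M X t))"
  have m_cont: "continuous_on {0..T} m"
    unfolding m_def
    by (rule continuous_on_subset[OF consensus_point_continuous[OF prob_space_axioms X paths f_cont bound]]) auto
  obtain L' \<epsilon>\<^sub>0 where L': "L' \<ge> 0" and \<epsilon>\<^sub>0: "\<epsilon>\<^sub>0 > 0"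
    and shift: "\<And>t y. t \<in> {0..T} \<Longrightarrow> norm y \<le> \<epsilon>\<^sub>0 \<Longrightarrow>
      norm (consensus_point f \<alpha> (distr M borel (\<lambda>\<omega>. X t \<omega> + y)) - m t) \<le> L' * norm y"
    unfolding m_def
    by (rule consensus_point_shift_lipschitz[OF prob_space_axioms X paths f_cont bound L less_imp_le[OF T_pos]]) (assumption, rule that, assumption, assumption, simp only: m_def)
  have main: "\<forall>\<^sub>F h in at_right 0. (SUP t\<in>{0..T}. W2 (law (M' h) (X' h) t) (law M X t)) \<le> ennreal \<epsilon>"
    if \<epsilon>: "\<epsilon> > 0" for \<epsilon>
  proof -
    \<comment> \<open>The majorant ends at \<open>min \<epsilon> \<epsilon>\<^sub>0\<close>: within
      the target accuracy, and within the radius where the consensus point is Lipschitz under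
      translations. The choice of \<open>w\<close> makes \<open>lam * T * w\<close> half of
      \<open>\<eta>\<close>.\<close>
    define \<eta> where "\<eta> = min \<epsilon> \<epsilon>\<^sub>0 / exp (lam * (L' + 1) * T)"
    define w where "w = \<eta> / (2 * lam * T)"
    have \<eta>: "\<eta> > 0" using \<epsilon> \<epsilon>\<^sub>0 by (simp add: \<eta>_def)
    have \<eta>_eq: "\<eta> * exp (lam * (L' + 1) * T) = min \<epsilon> \<epsilon>\<^sub>0" by (simp add: \<eta>_def)
    have w: "w > 0" "lam * T * w < \<eta>" using \<eta> lam_pos T_pos by (simp_all add: w_def)
    \<comment> \<open>Uniform continuity of the consensus path is the only restriction on the step
      size; it is independent of \<open>t\<close>.\<close>
    obtain d where d: "d > 0"
      "\<And>s u. s \<in> {0..T} \<Longrightarrow> u \<in> {0..T} \<Longrightarrow> dist u s < d \<Longrightarrow> dist (m u) (m s) < w"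
      using compact_uniformly_continuous[OF m_cont compact_Icc] w(1)
      unfolding uniformly_continuous_on_def by metis
    have "W2 (law (M' h) (X' h) t) (law M X t) \<le> ennreal \<epsilon>" if h: "0 < h" "h < d" and t: "t \<in> {0..T}" for h t
    proof -
      let ?m' = "\<lambda>t. consensus_point f \<alpha> (law (M' h) (X' h) (grid_time h t))"
      have sde': "additive_sde_solution (\<lambda>t x. - lam *\<^sub>R (x - ?m' t)) \<delta> (M' h) (F' h) (B' h) (X' h)"
        and law0': "law (M' h) (X' h) 0 = \<rho>0"
        using freezing[OF h(1)] by (auto simp: consensus_freezing_solution_def)
      obtain r where r: "continuous_on {0..} r"
        "\<And>t. t \<ge> 0 \<Longrightarrow> m integrable_on {0..t}" "\<And>t. t \<ge> 0 \<Longrightarrow> ?m' integrable_on {0..t}"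
        "\<And>t. t \<ge> 0 \<Longrightarrow> r t = lam *\<^sub>R (integral {0..t} ?m' - integral {0..t} m - integral {0..t} r)"
        and law_eq: "\<And>t. t \<ge> 0 \<Longrightarrow> law (M' h) (X' h) t = distr M borel (\<lambda>\<omega>. X t \<omega> + r t)"
        using linear_sde_law_shift[OF sde[folded m_def] sde' _ lam_pos] law0 law0' unfolding m_def by metis
      have "norm (r t) < \<eta> * exp (lam * (L' + 1) * t)"
      proof (rule frozen_shift_bound[OF h(1) lam_pos T_pos L' r, where \<epsilon> = \<epsilon>\<^sub>0 and w = w])
        fix s assume s: "s \<in> {0..T}" and small: "norm (r (grid_time h s)) \<le> \<epsilon>\<^sub>0"
        have g: "grid_time h s \<in> {0..T}" using grid_time_bounds[OF h(1), of s] s by auto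
        show "norm (?m' s - m (grid_time h s)) \<le> L' * norm (r (grid_time h s))"
          using shift[OF g small] law_eq[of "grid_time h s"] g by simp
      next
        fix s u assume "s \<in> {0..T}" "u \<in> {0..T}" "\<bar>s - u\<bar> < h"
        then show "norm (m s - m u) \<le> w" using d(2)[of u s] h by (simp add: dist_norm)
      qed (use \<eta> \<eta>_eq w t in auto)
      also have "\<dots> \<le> \<eta> * exp (lam * (L' + 1) * T)"
        using \<eta> lam_pos L' t by (intro mult_left_mono) auto
      finally have "norm (r t) \<le> \<epsilon>" by (simp add: \<eta>_eq)
      moreover have "W2 (law (M' h) (X' h) t) (law M X t) \<le> ennreal (norm (r t))"
        using W2_shift_le[OF prob_space_axioms X, of t "r t"] t by (simp add: law_eq) (simp add: law_def)
      ultimately show ?thesis by (meson ennreal_leI order_trans)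
    qed
    then have "(SUP t\<in>{0..T}. W2 (law (M' h) (X' h) t) (law M X t)) \<le> ennreal \<epsilon>" if "0 < h" "h < d" for h
      using that by (intro SUP_least)
    then show ?thesis unfolding eventually_at_right_field using d(1) by blast
  qed
  show ?thesis
  proof (rule order_tendstoI)
    fix a :: ennreal assume "0 < a"
    \<comment> \<open>\<open>a\<close> may be infinite; a value strictly between 0 and
      \<open>a\<close> is finite and supplies a real \<epsilon> for \<open>main\<close>.\<close>
    then obtain b where b: "0 < b" "b < a" using dense by blast
    define \<epsilon> where "\<epsilon> = enn2real b"
    have "b \<noteq> \<top>" using b by (metis top.not_eq_extremum less_trans neq_iff)
    then have "ennreal \<epsilon> = b" "\<epsilon> > 0" using b by (auto simp: \<epsilon>_def enn2real_positive_iff top.not_eq_extremum)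
    then show "\<forall>\<^sub>F h in at_right 0. (SUP t\<in>{0..T}. W2 (law (M' h) (X' h) t) (law M X t)) < a"
      using main[of \<epsilon>] b(2) by (auto elim!: eventually_mono intro: le_less_trans)
  qed simp
qed

end
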